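(* Let $\tau\in\mathbb{H}$. For any integer $r\ge1$, let $$f_r(\tau)=\operatorname{Tr}_{r-1}\bigl(\beta;G_2(\tau),G_4(\tau),\dots,G_{2(r-1)}(\tau)\bigr),\qquad g_r(\tau)=\sum_{t=0}^{r}(-1)^{r-t}\bigl(2(r-t)-1\bigr)G_{2(r-t)}(\tau)\,f_{t+1}(\tau),$$ with $G_0(\tau)=-1$. Then for all $r\ge 1$ and $z\in\mathbb{C}\setminus L_\tau$, $$\wp_{\{2\}^r}(z;\tau)=f_r(\tau)\,\wp_2(z;\tau)+g_r(\tau).$$
   Context: $\mathbb{H}$ is the upper half-plane, $L_\tau=\mathbb{Z}\tau+\mathbb{Z}$, $\mathbb{Z}_N=\{n\in\mathbb{Z}: |n|<N\}$, and $\mathbb{Z}_M\tau+\mathbb{Z}_N=\{m\tau+n: m\in\mathbb{Z}_M, n\in\mathbb{Z}_N\}$. The order $\prec$ on $L_\tau$: $m_1\tau+n_1\prec m_2\tau+n_2$ iff $m_1<m_2$, or $m_1=m_2$ and $n_1<n_2$. For integers $k_1,\dots,k_r\ge2$, $$\wp_{k_1,\dots,k_r}(z;\tau)=\lim_{M\to\infty}\lim_{N\to\infty}\sum_{\substack{w_1,\dots,w_r\in\mathbb{Z}_M\tau+\mathbb{Z}_N\\ w_1\prec\dots\prec w_r}}\frac{1}{(z-w_1)^{k_1}\cdots(z-w_r)^{k_r}},$$ and $\{2\}^r$ is the index $(2,\dots,2)$ with $r$ entries. For $k\ge2$, $G_k(\tau)=\lim_{M\to\infty}\lim_{N\to\infty}\sum_{(m,n)\in\mathbb{Z}_M\times\mathbb{Z}_N\setminus\{(0,0)\}}(m\tau+n)^{-k}$.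 A partition $\lambda\vdash n$ is written $\lambda=(1^{m_1},\dots,n^{m_n})$, where $m_k$ is the multiplicity of $k$. For a function $\phi$ on partitions, $\operatorname{Tr}_n(\phi;X_1,\dots,X_n)=\sum_{\lambda\vdash n}\phi(\lambda)\prod_{j=1}^nX_j^{m_j}$ for $n\ge1$, and $\operatorname{Tr}_0(\phi;-)=1$. Here $\beta(\lambda)=\prod_{k=1}^{n}\frac{1}{m_k!}\left(\frac{(-1)^{k-1}}{k}\right)^{m_k}$ for $\lambda\vdash n$. *)

theory Defs
  imports Complex_Main "HOL-Library.Multiset"
begin

definition period_lattice :: "complex \<Rightarrow> complex set" where
  "period_lattice \<tau> = {of_int m * \<tau> + of_int n | m n. True}"

definition ints_below :: "nat \<Rightarrow> int set" where
  "ints_below N = {n. \<bar>n\<bar> < int N}"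

definition lattice_box :: "complex \<Rightarrow> nat \<Rightarrow> nat \<Rightarrow> complex set" where
  "lattice_box \<tau> M N =
     {of_int m * \<tau> + of_int n | m n. m \<in> ints_below M \<and> n \<in> ints_below N}"

text \<open>For \<open>Im \<tau> > 0\<close> the coordinates of a lattice point are unique, so the
  existential quantifier only reads them off.\<close>

definition lattice_less :: "complex \<Rightarrow> complex \<Rightarrow> complex \<Rightarrow> bool" where
  "lattice_less \<tau> w1 w2 \<longleftrightarrow>
     (\<exists>m1 n1 m2 n2. w1 = of_int m1 * \<tau> + of_int n1 \<and> w2 = of_int m2 * \<tau> + of_int n2 \<and>
        (m1 < m2 \<or> (m1 = m2 \<and> n1 < n2)))"

text \<open>A chain \<open>w\<^sub>1 \<prec> \<dots> \<prec> w\<^sub>r\<close> is a list of length \<open>r\<close>; the index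
  \<open>(k\<^sub>1, \<dots>, k\<^sub>r)\<close> is the list \<open>ks\<close>, with entries counted from \<open>0\<close>.\<close>

definition lattice_chains :: "complex \<Rightarrow> nat \<Rightarrow> nat \<Rightarrow> nat \<Rightarrow> complex list set" where
  "lattice_chains \<tau> r M N =
     {ws. length ws = r \<and> set ws \<subseteq> lattice_box \<tau> M N \<and> sorted_wrt (lattice_less \<tau>) ws}"

definition multiple_wp :: "nat list \<Rightarrow> complex \<Rightarrow> complex \<Rightarrow> complex" where
  "multiple_wp ks z \<tau> =
     lim (\<lambda>M. lim (\<lambda>N. \<Sum>ws\<in>lattice_chains \<tau> (length ks) M N.
       1 / (\<Prod>i<length ks. (z - ws ! i) ^ (ks ! i))))"

text \<open>The value at \<open>k = 0\<close> is the convention \<open>G\<^sub>0 = -1\<close>, not a lattice sum.\<close>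

definition eisenstein_G :: "nat \<Rightarrow> complex \<Rightarrow> complex" where
  "eisenstein_G k \<tau> =
     (if k = 0 then -1
      else lim (\<lambda>M. lim (\<lambda>N. \<Sum>(m, n)\<in>ints_below M \<times> ints_below N - {(0, 0)}.
        1 / (of_int m * \<tau> + of_int n) ^ k)))"

text \<open>A partition is the multiset of its parts; the multiplicity \<open>m\<^sub>k\<close> is \<open>count p k\<close>.\<close>

definition partitions_of :: "nat \<Rightarrow> nat multiset set" where
  "partitions_of n = {p. 0 \<notin># p \<and> \<Sum>\<^sub># p = n}"

definition partition_trace ::
    "nat \<Rightarrow> (nat multiset \<Rightarrow> complex) \<Rightarrow> (nat \<Rightarrow> complex) \<Rightarrow> complex" where
  "partition_trace n \<phi> X =
     (if n = 0 then 1 else \<Sum>p\<in>partitions_of n. \<phi> p * (\<Prod>j=1..n. X j ^ count p j))"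

definition partition_beta :: "nat multiset \<Rightarrow> complex" where
  "partition_beta p =
     (\<Prod>k=1..\<Sum>\<^sub># p. 1 / fact (count p k) * ((-1) ^ (k - 1) / of_nat k) ^ count p k)"

definition coeff_f :: "nat \<Rightarrow> complex \<Rightarrow> complex" where
  "coeff_f r \<tau> = partition_trace (r - 1) partition_beta (\<lambda>j. eisenstein_G (2 * j) \<tau>)"

definition coeff_g :: "nat \<Rightarrow> complex \<Rightarrow> complex" where
  "coeff_g r \<tau> =
     (\<Sum>t=0..r. (-1) ^ (r - t) * (2 * of_nat (r - t) - 1) *
        eisenstein_G (2 * (r - t)) \<tau> * coeff_f (t + 1) \<tau>)"

end

theory Submission
  imports Defs "HOL-Complex_Analysis.Complex_Analysis"
begin

text \<open>
  The sum over chains is an elementary symmetric function \<open>e\<^sub>r\<close> of the numbers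
  \<open>1 / (z - w)\<^sup>2\<close>, with \<open>w\<close> in a finite box of the lattice. Newton's identities make it a universal
  polynomial in the power sums \<open>p\<^sub>k = \<Sum>w. 1 / (z - w)\<^bsup>2k\<^esup>\<close>; so the iterated limits only have to
  be taken in the power sums, and \<open>\<wp>\<^bsub>{2}\<^sup>r\<^esub>(z)\<close> is the same polynomial in the lattice series
  \<open>P\<^sub>k(z) = \<wp>\<^sub>2\<^sub>k(z)\<close>. The generating series of these polynomials is the exponential of
  \<open>\<Sum>k. (-1)\<^bsup>k-1\<^esup> p\<^sub>k t\<^sup>k / k\<close>. Hence it turns sums of power sums into products, and its
  expansion over partitions is the trace of \<open>\<beta>\<close>, so that \<open>f\<^sub>r = e\<^bsub>r-1\<^esub>(G\<^sub>2, G\<^sub>4, \<dots>)\<close>.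

  The function \<open>e\<^sub>r(z)\<close> is invariant under the lattice. Although it is a polynomial of high degree
  in the \<open>P\<^sub>k\<close>, its pole at \<open>0\<close> has order at most two, because every lattice point occurs at
  most once in a chain: separating the point \<open>w = 0\<close> gives
  \<open>e\<^sub>r(z) = e'\<^sub>r(z) + e'\<^bsub>r-1\<^esub>(z) / z\<^sup>2\<close>, where \<open>e'\<close> is formed from the series without that point and is
  holomorphic and even near \<open>0\<close>. Since \<open>e'\<^bsub>r-1\<^esub>(0) = f\<^sub>r\<close>, the difference
  \<open>e\<^sub>r - f\<^sub>r \<wp>\<^sub>2\<close> has a limit at \<open>0\<close>, extends to an entire doubly periodic function, and is
  constant by Liouville's theorem. The constant is that limit. The only contribution to it that is
  not a value at \<open>0\<close> is the coefficient of \<open>z\<^sup>2\<close> in \<open>e'\<^bsub>r-1\<^esub>\<close>, for which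
  the expansion \<open>P'\<^sub>k(z) = G\<^sub>2\<^sub>k + k (2k + 1) G\<^bsub>2k+2\<^esub> z\<^sup>2 + \<dots>\<close> of the punctured power sums and
  multiplicativity of the generating series suffice; the result is \<open>g\<^sub>r\<close>.

  The series \<open>P\<^sub>1\<close> converges only conditionally. Subtracting \<open>1 / (w\<^sup>2 - 1/4)\<close> from
  each term makes it absolutely convergent, and changes no iterated limit because these
  corrections telescope to \<open>0\<close> along each row of the lattice. The same device gives the invariance
  of \<open>P\<^sub>1\<close> under the lattice.
\<close>

unbundle no vec_syntax

section \<open>Elementary symmetric functions from power sums\<close>

text \<open>
  Newton's identities \<open>n e\<^sub>n = \<Sum>\<^sub>i e\<^sub>i (-1)\<^bsup>n-1-i\<^esup> p\<^bsub>n-i\<^esub>\<close>, read as a recursive definition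
  of \<open>e\<^sub>n\<close> from an arbitrary sequence \<open>p\<^sub>1, p\<^sub>2, \<dots>\<close>.
  In this form limits and holomorphy pass from \<open>p\<close> to \<open>e\<^sub>n\<close>, even if
  \<open>p\<close> is not the sequence of power sums of a finite set.
\<close>

fun newton_elem :: "(nat \<Rightarrow> complex) \<Rightarrow> nat \<Rightarrow> complex" where
  "newton_elem p 0 = 1"
| "newton_elem p (Suc r) =
     (\<Sum>i\<le>r. newton_elem p i * ((-1) ^ (r - i) * p (Suc (r - i)))) / of_nat (Suc r)"

definition newton_fps :: "(nat \<Rightarrow> complex) \<Rightarrow> complex fps" where
  "newton_fps p = Abs_fps (newton_elem p)"

text \<open>
  The logarithmic derivative of the generating series of the \<open>e\<^sub>n\<close>.
\<close>

definition power_sum_fps :: "(nat \<Rightarrow> complex) \<Rightarrow> complex fps" where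
  "power_sum_fps p = Abs_fps (\<lambda>k. (-1) ^ k * p (Suc k))"

lemma newton_fps_nth [simp]: "newton_fps p $ n = newton_elem p n"
  by (simp add: newton_fps_def)

lemma fps_deriv_newton_fps: "fps_deriv (newton_fps p) = newton_fps p * power_sum_fps p"
proof (rule fps_ext)
  fix n
  have "of_nat (Suc n) * newton_elem p (Suc n) =
          (\<Sum>i\<le>n. newton_elem p i * ((-1) ^ (n - i) * p (Suc (n - i))))"
    by (simp del: of_nat_Suc)
  then show "fps_deriv (newton_fps p) $ n = (newton_fps p * power_sum_fps p) $ n"
    by (simp add: fps_mult_nth power_sum_fps_def atLeast0AtMost del: newton_elem.simps(2))
qed

text \<open>
  The differential equation \<open>F' = F Q\<close> with \<open>F(0) = 1\<close> determines all coefficients. This replaces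
  the exponential formula: identities between generating series are checked on logarithmic
  derivatives.
\<close>

lemma newton_fps_unique:
  assumes "F $ 0 = 1" and "fps_deriv F = F * power_sum_fps p"
  shows "F = newton_fps p"
proof (rule fps_ext)
  fix n show "F $ n = newton_fps p $ n"
  proof (induction n rule: less_induct)
    case (less n)
    show ?case
    proof (cases n)
      case 0
      then show ?thesis using assms(1) by simp
    next
      case (Suc r)
      have "of_nat (Suc r) * F $ Suc r = (F * power_sum_fps p) $ r"
        using arg_cong[OF assms(2), of "\<lambda>G. G $ r"] by simp
      also have "\<dots> = (newton_fps p * power_sum_fps p) $ r"
        unfolding fps_mult_nth by (rule sum.cong) (use less Suc in auto)
      also have "\<dots> = fps_deriv (newton_fps p) $ r"
        by (simp only: fps_deriv_newton_fps)
      also have "\<dots> = of_nat (Suc r) * newton_fps p $ Suc r"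
        by simp
      finally show ?thesis
        using Suc by (simp del: of_nat_Suc newton_elem.simps)
    qed
  qed
qed

text \<open>
  The generating series is an exponential in \<open>p\<close>; on logarithmic derivatives the claim is
  additivity.
\<close>

lemma newton_fps_add: "newton_fps (\<lambda>k. p k + q k) = newton_fps p * newton_fps q"
proof (rule newton_fps_unique[symmetric])
  have "power_sum_fps (\<lambda>k. p k + q k) = power_sum_fps p + power_sum_fps q"
    by (rule fps_ext) (simp add: power_sum_fps_def algebra_simps)
  then show "fps_deriv (newton_fps p * newton_fps q) =
      newton_fps p * newton_fps q * power_sum_fps (\<lambda>k. p k + q k)"
    by (simp add: fps_deriv_newton_fps algebra_simps)
qed simp

lemma newton_elem_add:
  "newton_elem (\<lambda>k. p k + q k) n = (\<Sum>i\<le>n. newton_elem p i * newton_elem q (n - i))"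
  using arg_cong[OF newton_fps_add, of "\<lambda>F. F $ n" p q]
  by (simp add: fps_mult_nth atLeast0AtMost)

lemma newton_fps_powers: "newton_fps (\<lambda>k. a ^ k) = 1 + fps_const a * fps_X"
proof (rule newton_fps_unique[symmetric])
  show "fps_deriv (1 + fps_const a * fps_X) =
      (1 + fps_const a * fps_X) * power_sum_fps (\<lambda>k. a ^ k)"
  proof (rule fps_ext)
    fix n show "fps_deriv (1 + fps_const a * fps_X) $ n =
      ((1 + fps_const a * fps_X) * power_sum_fps (\<lambda>k. a ^ k)) $ n"
      by (cases n) (simp_all add: power_sum_fps_def ring_distribs mult.assoc)
  qed
qed simp

lemma newton_fps_zero: "newton_fps (\<lambda>k. 0) = 1"
  by (rule newton_fps_unique[symmetric]) (simp_all add: power_sum_fps_def fps_eq_iff)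

lemma newton_elem_zero: "newton_elem (\<lambda>k. 0) n = (if n = 0 then 1 else 0)"
  using arg_cong[OF newton_fps_zero, of "\<lambda>F. F $ n"] by (simp del: newton_elem.simps)

text \<open>
  By multiplicativity, each member of the family contributes one linear factor.
\<close>

lemma newton_fps_power_sums:
  "finite S \<Longrightarrow> newton_fps (\<lambda>k. \<Sum>x\<in>S. f x ^ k) = (\<Prod>x\<in>S. 1 + fps_const (f x) * fps_X)"
  by (induction S rule: finite_induct)
     (simp_all add: newton_fps_zero newton_fps_add newton_fps_powers)

text \<open>
  Adding one point \<open>a\<close> to the family. Later \<open>a = 1 / z\<^sup>2\<close> is the contribution of the lattice
  point \<open>0\<close>; its appearing only linearly is what keeps the pole of order two.
\<close>

lemma newton_elem_add_powers:
  "newton_elem (\<lambda>k. p k + a ^ k) (Suc r) = newton_elem p (Suc r) + a * newton_elem p r"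
proof -
  have "newton_fps (\<lambda>k. p k + a ^ k) = newton_fps p + fps_const a * (fps_X * newton_fps p)"
    by (simp add: newton_fps_add newton_fps_powers algebra_simps)
  from arg_cong[OF this, of "\<lambda>F. F $ Suc r"] show ?thesis
    by (simp del: newton_elem.simps)
qed

lemma newton_elem_cong:
  "(\<And>k. 1 \<le> k \<Longrightarrow> p k = q k) \<Longrightarrow> newton_elem p n = newton_elem q n"
proof (induction n rule: less_induct)
  case (less n)
  then show ?case by (cases n) (auto intro!: sum.cong)
qed

lemma tendsto_newton_elem:
  assumes "\<And>k. 1 \<le> k \<Longrightarrow> ((\<lambda>x. p x k) \<longlongrightarrow> q k) F"
  shows "((\<lambda>x. newton_elem (p x) n) \<longlongrightarrow> newton_elem q n) F"
proof (induction n rule: less_induct)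
  case (less n)
  then show ?case
    by (cases n) (auto intro!: tendsto_intros assms simp del: of_nat_Suc)
qed

lemma holomorphic_newton_elem:
  assumes "\<And>k. 1 \<le> k \<Longrightarrow> (\<lambda>x. p x k) holomorphic_on A"
  shows "(\<lambda>x. newton_elem (p x) n) holomorphic_on A"
proof (induction n rule: less_induct)
  case (less n)
  then show ?case
    by (cases n) (auto intro!: holomorphic_intros assms simp del: of_nat_Suc)
qed

text \<open>
  If all \<open>q\<^sub>k\<close> are of order \<open>z\<^sup>2\<close>, then the products of at least two of them are of
  order \<open>z\<^sup>4\<close>, and what remains is the linear term \<open>(-1)\<^bsup>k-1\<^esup> q\<^sub>k / k\<close> of the exponential.
\<close>

lemma newton_elem_linear_term:
  fixes q :: "complex \<Rightarrow> nat \<Rightarrow> complex"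
  assumes q: "\<And>k. 1 \<le> k \<Longrightarrow> ((\<lambda>z. q z k / z\<^sup>2) \<longlongrightarrow> \<rho> k) (at 0)"
  shows "((\<lambda>z. newton_elem (q z) (Suc m) / z\<^sup>2) \<longlongrightarrow> (-1) ^ m * \<rho> (Suc m) / of_nat (Suc m)) (at 0)"
proof -
  have "((\<lambda>z. q z k) \<longlongrightarrow> 0) (at 0)" if k: "1 \<le> k" for k
  proof -
    have "((\<lambda>z. q z k / z\<^sup>2 * z\<^sup>2) \<longlongrightarrow> \<rho> k * 0\<^sup>2) (at 0)"
      by (intro tendsto_intros q k)
    then have "((\<lambda>z. q z k / z\<^sup>2 * z\<^sup>2) \<longlongrightarrow> 0) (at 0)" by simp
    then show ?thesis
      by (rule Lim_transform_eventually) (auto simp: eventually_at_filter)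
  qed
  then have lim0: "((\<lambda>z. newton_elem (q z) i) \<longlongrightarrow> newton_elem (\<lambda>k. 0) i) (at 0)" for i
    by (rule tendsto_newton_elem)
  have "((\<lambda>z. (\<Sum>i\<le>m. newton_elem (q z) i * ((-1) ^ (m - i) * (q z (Suc (m - i)) / z\<^sup>2))) / of_nat (Suc m))
      \<longlongrightarrow> (\<Sum>i\<le>m. newton_elem (\<lambda>k. 0) i * ((-1) ^ (m - i) * \<rho> (Suc (m - i)))) / of_nat (Suc m)) (at 0)"
    by (intro tendsto_divide tendsto_sum tendsto_mult lim0 q tendsto_const) (simp_all del: of_nat_Suc)
  moreover have "(\<Sum>i\<le>m. newton_elem (\<lambda>k. 0) i * ((-1) ^ (m - i) * \<rho> (Suc (m - i)))) = (-1) ^ m * \<rho> (Suc m)"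
    by (simp add: newton_elem_zero if_distrib[of "\<lambda>x. x * _"] cong: if_cong)
  ultimately show ?thesis
    by (simp add: sum_divide_distrib mult.commute[of "of_nat (Suc m) :: complex"] del: of_nat_Suc)
qed

section \<open>Sums over chains\<close>

text \<open>
  For a strict total order a chain is the increasing enumeration of a subset. The induction removes
  the maximum \<open>m\<close> of \<open>S\<close>: a chain either avoids \<open>m\<close> or ends in it, and this is multiplication by
  \<open>1 + f(m) X\<close>.
\<close>

lemma sum_chains_eq_coeff:
  fixes f :: "'a \<Rightarrow> complex"
  assumes "finite S" "transp_on S R" "asymp_on S R" "totalp_on S R"
  shows "(\<Sum>ws | length ws = r \<and> set ws \<subseteq> S \<and> sorted_wrt R ws. prod_list (map f ws)) =
           (\<Prod>x\<in>S. 1 + fps_const (f x) * fps_X) $ r"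
  using assms
proof (induction S arbitrary: r rule: finite_psubset_induct)
  case (psubset S)
  let ?C = "\<lambda>r S. {ws. length ws = r \<and> set ws \<subseteq> S \<and> sorted_wrt R ws}"
  show ?case
  proof (cases r)
    case 0
    then have "?C r S = {[]}" by auto
    moreover have "(\<Prod>x\<in>S. 1 + fps_const (f x) * fps_X) $ 0 = 1"
      by (simp flip: newton_fps_power_sums[OF psubset.hyps])
    ultimately show ?thesis using 0 by simp
  next
    case (Suc r')
    show ?thesis
    proof (cases "S = {}")
      case True
      then show ?thesis using Suc by auto
    next
      case False
      then obtain m where m: "m \<in> S" "\<forall>x\<in>S. x \<noteq> m \<longrightarrow> \<not> R m x"
        using Finite_Set.bex_max_element[OF psubset.hyps] psubset.prems by blast
      have Rm: "R x m" if "x \<in> S" "x \<noteq> m" for x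
        using m that psubset.prems(3) by (auto simp: totalp_on_def)
      have irr: "\<not> R m m"
        using m psubset.prems(2) by (auto simp: asymp_on_def)
      define S' where "S' = S - {m}"
      have S': "S' \<subset> S" "finite S'" "S = insert m S'" "m \<notin> S'"
        using m psubset.hyps by (auto simp: S'_def)
      have IH: "(\<Sum>ws\<in>?C r S'. prod_list (map f ws)) = (\<Prod>x\<in>S'. 1 + fps_const (f x) * fps_X) $ r" for r
        using S'(1) psubset.prems
        by (intro psubset.IH) (auto intro: transp_on_subset asymp_on_subset totalp_on_subset)
      have fin: "finite (?C k S')" for k
        by (rule finite_subset[OF _ finite_lists_length_eq[OF S'(2), of k]]) auto
      have split: "?C r S = ?C r S' \<union> (\<lambda>ws. ws @ [m]) ` ?C r' S'"
      proof (intro equalityI subsetI)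
        fix ws assume ws: "ws \<in> ?C r S"
        show "ws \<in> ?C r S' \<union> (\<lambda>ws. ws @ [m]) ` ?C r' S'"
        proof (cases "m \<in> set ws")
          case False
          then show ?thesis using ws S' by auto
        next
          case True
          obtain vs l where vl: "ws = vs @ [l]"
            using ws Suc by (cases ws rule: rev_cases) auto
          have srt: "sorted_wrt R vs" "\<forall>x\<in>set vs. R x l"
            using ws vl by (auto simp: sorted_wrt_append)
          have lm: "l = m"
          proof (rule ccontr)
            assume "l \<noteq> m"
            then have "R m l" using srt True vl by auto
            then show False using m ws vl \<open>l \<noteq> m\<close> by auto
          qed
          then have "m \<notin> set vs" using srt irr by auto
          then have "vs \<in> ?C r' S'" using ws vl srt S' Suc by auto
          then show ?thesis using vl lm by blast
        qed
      next
        fix ws assume "ws \<in> ?C r S' \<union> (\<lambda>ws. ws @ [m]) ` ?C r' S'"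
        then show "ws \<in> ?C r S"
          using S'(3,4) Suc Rm by (auto simp: sorted_wrt_append intro!: Rm)
      qed
      have "(\<Sum>ws\<in>?C r S. prod_list (map f ws)) =
          (\<Sum>ws\<in>?C r S'. prod_list (map f ws)) + (\<Sum>ws\<in>(\<lambda>ws. ws @ [m]) ` ?C r' S'. prod_list (map f ws))"
        unfolding split by (rule sum.union_disjoint) (use S' fin in auto)
      also have "(\<Sum>ws\<in>(\<lambda>ws. ws @ [m]) ` ?C r' S'. prod_list (map f ws)) =
          (\<Sum>ws\<in>?C r' S'. prod_list (map f ws) * f m)"
        by (subst sum.reindex) (auto intro: inj_onI)
      also have "\<dots> = (\<Sum>ws\<in>?C r' S'. prod_list (map f ws)) * f m"
        by (simp add: sum_distrib_right)
      finally show ?thesis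
        using S' Suc by (simp add: IH distrib_right mult.assoc)
    qed
  qed
qed

section \<open>Traces over partitions\<close>

lemma part_le: "k \<in># p \<Longrightarrow> k \<le> \<Sum>\<^sub># p" for p :: "nat multiset"
  by (auto dest!: multi_member_split)

lemma weighted_counts_eq_sum_mset:
  fixes p :: "nat multiset"
  assumes "set_mset p \<subseteq> {1..n}"
  shows "(\<Sum>k=1..n. k * count p k) = \<Sum>\<^sub># p"
  using assms
proof (induction p)
  case empty
  then show ?case by simp
next
  case (add x p)
  have "(\<Sum>k=1..n. k * count (add_mset x p) k) =
      (\<Sum>k=1..n. k * count p k) + (\<Sum>k=1..n. if k = x then k else 0)"
    unfolding sum.distrib[symmetric] by (rule sum.cong) auto
  then show ?case using add by simp
qed

lemma partition_parts: "p \<in> partitions_of n \<Longrightarrow> set_mset p \<subseteq> {1..n}"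
proof
  fix k assume "p \<in> partitions_of n" "k \<in># p"
  then have "k \<noteq> 0" "k \<le> n"
    using part_le[of k p] unfolding partitions_of_def by (metis (mono_tags) mem_Collect_eq)+
  then show "k \<in> {1..n}" by simp
qed

lemma add_part_bij_betw:
  assumes "1 \<le> k" "k \<le> n"
  shows "bij_betw (add_mset k) (partitions_of (n - k)) {p \<in> partitions_of n. k \<in># p}"
proof (rule bij_betwI[where g = "\<lambda>p. p - {#k#}"])
  show "add_mset k \<in> partitions_of (n - k) \<rightarrow> {p \<in> partitions_of n. k \<in># p}"
  proof
    fix q assume "q \<in> partitions_of (n - k)"
    then have "0 \<notin># q" "\<Sum>\<^sub># q = n - k" by (simp_all add: partitions_of_def)
    then have "0 \<notin># add_mset k q" "\<Sum>\<^sub># (add_mset k q) = n" using assms by simp_all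
    then show "add_mset k q \<in> {p \<in> partitions_of n. k \<in># p}" by (simp add: partitions_of_def)
  qed
  show "(\<lambda>p. p - {#k#}) \<in> {p \<in> partitions_of n. k \<in># p} \<rightarrow> partitions_of (n - k)"
  proof
    fix p assume p: "p \<in> {p \<in> partitions_of n. k \<in># p}"
    then obtain q where q: "p = add_mset k q" by (auto dest: multi_member_split)
    from p have "0 \<notin># p" "\<Sum>\<^sub># p = n" by (simp_all add: partitions_of_def)
    then have "0 \<notin># q" "\<Sum>\<^sub># q = n - k" unfolding q by auto
    then show "p - {#k#} \<in> partitions_of (n - k)" by (simp add: q partitions_of_def)
  qed
  show "add_mset k q - {#k#} = q" for q by simp
  show "add_mset k (p - {#k#}) = p" if "p \<in> {p \<in> partitions_of n. k \<in># p}" for p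
    using that by simp
qed

text \<open>
  Finiteness must be known before partition sums can be manipulated, since sums over infinite sets
  are \<open>0\<close> by convention.
\<close>

lemma finite_partitions_of: "finite (partitions_of n)"
proof (induction n rule: less_induct)
  case (less n)
  have "partitions_of n \<subseteq> insert {#} (\<Union>k\<in>{1..n}. add_mset k ` partitions_of (n - k))"
  proof
    fix p assume p: "p \<in> partitions_of n"
    show "p \<in> insert {#} (\<Union>k\<in>{1..n}. add_mset k ` partitions_of (n - k))"
    proof (cases "p = {#}")
      case False
      then obtain k where k: "k \<in># p" by auto
      then have "k \<in> {1..n}" using partition_parts[OF p] by auto
      moreover from this add_part_bij_betw[of k n] p k
      have "p \<in> add_mset k ` partitions_of (n - k)" by (auto simp: bij_betw_def)
      ultimately show ?thesis by blast
    qed simp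
  qed
  then show ?case
    by (rule finite_subset) (use less in auto)
qed

text \<open>
  The summand of the trace of \<open>\<beta>\<close>. The upper bound \<open>n\<close> is independent of the
  partition, so that partitions of different numbers can be compared.
\<close>

definition partition_weight :: "(nat \<Rightarrow> complex) \<Rightarrow> nat \<Rightarrow> nat multiset \<Rightarrow> complex" where
  "partition_weight X n p =
     (\<Prod>k=1..n. ((-1) ^ (k - 1) * X k / of_nat k) ^ count p k / fact (count p k))"

lemma partition_weight_extend:
  assumes "p \<in> partitions_of m" "m \<le> n"
  shows "partition_weight X n p = partition_weight X m p"
  unfolding partition_weight_def
proof (rule prod.mono_neutral_right)
  show "\<forall>i\<in>{1..n} - {1..m}. ((-1) ^ (i - 1) * X i / of_nat i) ^ count p i / fact (count p i) = 1"
  proof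
    fix i assume "i \<in> {1..n} - {1..m}"
    then have "count p i = 0" using partition_parts[OF assms(1)] by (auto simp: count_eq_zero_iff)
    then show "((-1) ^ (i - 1) * X i / of_nat i) ^ count p i / fact (count p i) = 1" by simp
  qed
qed (use assms in auto)

text \<open>
  Marking one of the parts equal to \<open>k\<close>, with weight \<open>k\<close>, and removing it: the factorial in the
  weight absorbs the multiplicity.
\<close>

lemma partition_weight_add_part:
  assumes "1 \<le> k" "k \<le> n"
  shows "of_nat (k * count (add_mset k q) k) * partition_weight X n (add_mset k q) =
           (-1) ^ (k - 1) * X k * partition_weight X n q"
proof -
  let ?g = "\<lambda>q j. ((-1) ^ (j - 1) * X j / of_nat j) ^ count q j / fact (count q j) :: complex"
  have *: "partition_weight X n q' = ?g q' k * (\<Prod>j\<in>{1..n}-{k}. ?g q' j)" for q'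
    unfolding partition_weight_def by (rule prod.remove) (use assms in auto)
  have "(\<Prod>j\<in>{1..n}-{k}. ?g (add_mset k q) j) = (\<Prod>j\<in>{1..n}-{k}. ?g q j)"
    by (rule prod.cong) auto
  moreover have "of_nat (k * count (add_mset k q) k) * ?g (add_mset k q) k =
      (-1) ^ (k - 1) * X k * ?g q k"
  proof -
    let ?c = "(-1) ^ (k - 1) * X k / of_nat k"
    have "of_nat (k * Suc m) * (?c ^ Suc m / fact (Suc m)) = of_nat k * ?c * (?c ^ m / fact m)" for m
      unfolding of_nat_mult fact_Suc power_Suc by (simp del: of_nat_Suc)
    moreover have "of_nat k * ?c = (-1) ^ (k - 1) * X k" using assms by simp
    ultimately show ?thesis by (simp only: count_add_mset simp_thms if_True)
  qed
  ultimately show ?thesis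
    unfolding *[of q] *[of "add_mset k q"] by (metis (no_types, lifting) mult.assoc)
qed

text \<open>
  Multiplying by \<open>n = \<Sum>\<^sub>k k m\<^sub>k\<close> marks a part in every partition of \<open>n\<close>. Removing the
  marked part \<open>k\<close> leaves an arbitrary partition of \<open>n - k\<close>, which gives Newton's
  recursion.
\<close>

lemma sum_partition_weight_eq_newton_elem:
  "(\<Sum>p\<in>partitions_of n. partition_weight X n p) = newton_elem X n"
proof (induction n rule: less_induct)
  case (less n)
  show ?case
  proof (cases n)
    case 0
    have "partitions_of 0 = {{#}}" by (auto simp: partitions_of_def) (metis multiset_nonemptyE)
    then show ?thesis using 0 by (simp add: partition_weight_def)
  next
    case (Suc r)
    have "of_nat n * (\<Sum>p\<in>partitions_of n. partition_weight X n p) =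
        (\<Sum>p\<in>partitions_of n. \<Sum>k=1..n. of_nat (k * count p k) * partition_weight X n p)"
      unfolding sum_distrib_left
    proof (rule sum.cong)
      fix p assume p: "p \<in> partitions_of n"
      then have "(\<Sum>k=1..n. k * count p k) = n"
        using weighted_counts_eq_sum_mset[OF partition_parts[OF p]] by (simp add: partitions_of_def)
      then have "of_nat n = (\<Sum>k=1..n. of_nat (k * count p k) :: complex)"
        by (metis of_nat_sum)
      then show "of_nat n * partition_weight X n p =
          (\<Sum>k=1..n. of_nat (k * count p k) * partition_weight X n p)"
        by (simp only: sum_distrib_right)
    qed simp
    also have "\<dots> = (\<Sum>k=1..n. \<Sum>p\<in>partitions_of n. of_nat (k * count p k) * partition_weight X n p)"
      by (rule sum.swap)
    also have "\<dots> = (\<Sum>k=1..n. (-1) ^ (k - 1) * X k * newton_elem X (n - k))"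
    proof (rule sum.cong)
      fix k assume "k \<in> {1..n}"
      then have k: "1 \<le> k" "k \<le> n" by auto
      have "(\<Sum>p\<in>partitions_of n. of_nat (k * count p k) * partition_weight X n p) =
          (\<Sum>p\<in>{p \<in> partitions_of n. k \<in># p}. of_nat (k * count p k) * partition_weight X n p)"
        by (rule sum.mono_neutral_right) (auto simp: finite_partitions_of not_in_iff)
      also have "\<dots> = (\<Sum>q\<in>partitions_of (n - k).
          of_nat (k * count (add_mset k q) k) * partition_weight X n (add_mset k q))"
        by (rule sum.reindex_bij_betw[OF add_part_bij_betw[OF k], symmetric])
      also have "\<dots> = (\<Sum>q\<in>partitions_of (n - k). (-1) ^ (k - 1) * X k * partition_weight X (n - k) q)"
        by (intro sum.cong refl) (simp only: partition_weight_add_part[OF k] partition_weight_extend[OF _ diff_le_self])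
      also have "\<dots> = (-1) ^ (k - 1) * X k * newton_elem X (n - k)"
        using less[of "n - k"] k by (simp add: sum_distrib_left[symmetric])
      finally show "(\<Sum>p\<in>partitions_of n. of_nat (k * count p k) * partition_weight X n p) =
          (-1) ^ (k - 1) * X k * newton_elem X (n - k)" .
    qed simp
    also have "\<dots> = (\<Sum>i\<le>r. newton_elem X i * ((-1) ^ (r - i) * X (Suc (r - i))))"
      by (rule sum.reindex_bij_witness[of _ "\<lambda>i. n - i" "\<lambda>k. n - k"])
         (use Suc in \<open>auto simp: Suc_diff_le\<close>)
    also have "\<dots> = of_nat n * newton_elem X n"
      using Suc by (simp del: of_nat_Suc)
    finally show ?thesis using Suc by (simp del: of_nat_Suc newton_elem.simps)
  qed
qed

lemma partition_trace_beta: "partition_trace n partition_beta X = newton_elem X n"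
proof (cases "n = 0")
  case False
  have "partition_beta p * (\<Prod>j=1..n. X j ^ count p j) = partition_weight X n p"
    if "p \<in> partitions_of n" for p
    using that
    by (simp add: partition_beta_def partition_weight_def partitions_of_def
        prod.distrib[symmetric] power_mult_distrib power_divide mult_ac)
  then show ?thesis
    using False by (simp add: partition_trace_def sum_partition_weight_eq_newton_elem[symmetric])
qed (simp add: partition_trace_def)

section \<open>Iterated limits\<close>

text \<open>
  The inner limit is required to exist for every \<open>M\<close>, so that the limits in the definitions of
  \<open>\<wp>\<close> and \<open>G\<close> are determined by it.
\<close>

definition iter_lim :: "(nat \<Rightarrow> nat \<Rightarrow> complex) \<Rightarrow> complex \<Rightarrow> bool" where
  "iter_lim F L \<longleftrightarrow> (\<exists>g. (\<forall>M. F M \<longlonglongrightarrow> g M) \<and> g \<longlonglongrightarrow> L)"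

lemma iter_lim_unique: "iter_lim F L \<Longrightarrow> lim (\<lambda>M. lim (F M)) = L"
proof -
  assume "iter_lim F L"
  then obtain g where g: "\<And>M. F M \<longlonglongrightarrow> g M" "g \<longlonglongrightarrow> L" by (auto simp: iter_lim_def)
  then have "lim (F M) = g M" for M by (intro limI)
  then show "lim (\<lambda>M. lim (F M)) = L" using g(2) by (simp add: limI)
qed

lemma iter_lim_add:
  assumes "iter_lim F a" "iter_lim G b"
  shows "iter_lim (\<lambda>M N. F M N + G M N) (a + b)"
proof -
  obtain f g where fg: "\<And>M. F M \<longlonglongrightarrow> f M" "f \<longlonglongrightarrow> a" "\<And>M. G M \<longlonglongrightarrow> g M" "g \<longlonglongrightarrow> b"
    using assms by (auto simp: iter_lim_def)
  show ?thesis
    unfolding iter_lim_def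
    by (rule exI[of _ "\<lambda>M. f M + g M"]) (auto intro!: tendsto_add fg)
qed

lemma iter_lim_uminus:
  assumes "iter_lim F a"
  shows "iter_lim (\<lambda>M N. - F M N) (- a)"
proof -
  obtain f where f: "\<And>M. F M \<longlonglongrightarrow> f M" "f \<longlonglongrightarrow> a"
    using assms by (auto simp: iter_lim_def)
  show ?thesis
    unfolding iter_lim_def
    by (rule exI[of _ "\<lambda>M. - f M"]) (auto intro!: tendsto_minus f)
qed

lemma iter_lim_newton_elem:
  assumes "\<And>k. 1 \<le> k \<Longrightarrow> iter_lim (\<lambda>M N. p M N k) (q k)"
  shows "iter_lim (\<lambda>M N. newton_elem (p M N) n) (newton_elem q n)"
proof -
  have "\<exists>g. \<forall>k\<ge>1. (\<forall>M. (\<lambda>N. p M N k) \<longlonglongrightarrow> g k M) \<and> g k \<longlonglongrightarrow> q k"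
    using assms unfolding iter_lim_def by metis
  then obtain g where g: "\<And>k M. 1 \<le> k \<Longrightarrow> (\<lambda>N. p M N k) \<longlonglongrightarrow> g k M" "\<And>k. 1 \<le> k \<Longrightarrow> g k \<longlonglongrightarrow> q k"
    by blast
  show ?thesis
    unfolding iter_lim_def
    by (rule exI[of _ "\<lambda>M. newton_elem (\<lambda>k. g k M) n"])
       (auto intro!: tendsto_newton_elem g)
qed

lemma finite_ints_below [simp]: "finite (ints_below N)"
  by (rule finite_subset[of _ "{- int N..int N}"]) (auto simp: ints_below_def)

lemma filterlim_ints_below: "filterlim ints_below (finite_subsets_at_top UNIV) sequentially"
  unfolding filterlim_finite_subsets_at_top
proof safe
  fix X :: "int set" assume X: "finite X"
  then obtain B where B: "\<And>x. x \<in> X \<Longrightarrow> \<bar>x\<bar> \<le> B"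
    by (metis (no_types, opaque_lifting) bdd_above.unfold bdd_above_finite finite_imageI image_eqI)
  have "X \<subseteq> ints_below N" if "nat B + 1 \<le> N" for N
    using B that by (fastforce simp: ints_below_def)
  then show "\<forall>\<^sub>F N in sequentially. finite (ints_below N) \<and> X \<subseteq> ints_below N \<and> ints_below N \<subseteq> UNIV"
    unfolding eventually_sequentially by auto
qed

text \<open>
  Absolute convergence over the plane gives the iterated limit: first each row is
  summed, then the row sums.
\<close>

lemma has_sum_imp_iter_lim:
  fixes f :: "int \<times> int \<Rightarrow> complex"
  assumes "(f has_sum s) UNIV"
  shows "iter_lim (\<lambda>M N. \<Sum>p\<in>ints_below M \<times> ints_below N. f p) s"
proof -
  define r where "r m = (\<Sum>\<^sub>\<infinity>n. f (m, n))" for m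
  have "(\<lambda>(m, n). f (m, n)) summable_on (UNIV \<times> UNIV)"
    using assms by (auto simp: summable_on_def)
  then have row: "((\<lambda>n. f (m, n)) has_sum r m) UNIV" for m
    unfolding r_def by (intro has_sum_infsum) (rule summable_on_SigmaD1[where A = UNIV and B = "\<lambda>_. UNIV"], auto)
  have "(r has_sum s) UNIV"
    by (rule has_sum_SigmaD[where B = "\<lambda>_. UNIV"]) (use assms row in auto)
  then have "(\<lambda>M. \<Sum>m\<in>ints_below M. r m) \<longlonglongrightarrow> s"
    unfolding has_sum_def by (rule filterlim_compose[OF _ filterlim_ints_below])
  moreover have "(\<lambda>N. \<Sum>p\<in>ints_below M \<times> ints_below N. f p) \<longlonglongrightarrow> (\<Sum>m\<in>ints_below M. r m)" for M
  proof -
    have "(\<lambda>N. \<Sum>m\<in>ints_below M. \<Sum>n\<in>ints_below N. f (m, n)) \<longlonglongrightarrow> (\<Sum>m\<in>ints_below M. r m)"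
      by (intro tendsto_sum) (use row in \<open>auto simp: has_sum_def intro: filterlim_compose[OF _ filterlim_ints_below]\<close>)
    then show ?thesis by (simp add: sum.cartesian_product)
  qed
  ultimately show ?thesis
    unfolding iter_lim_def by (intro exI[of _ "\<lambda>M. \<Sum>m\<in>ints_below M. r m"]) auto
qed

lemma sum_ints_below_telescope:
  fixes h :: "int \<Rightarrow> 'a :: ab_group_add"
  shows "(\<Sum>n\<in>ints_below (Suc N). h n - h (n + 1)) = h (- int N) - h (int N + 1)"
proof (induction N)
  case 0
  have "ints_below (Suc 0) = {0}" by (auto simp: ints_below_def)
  then show ?case by simp
next
  case (Suc N)
  have "ints_below (Suc (Suc N)) = insert (int N + 1) (insert (- int N - 1) (ints_below (Suc N)))"
    by (auto simp: ints_below_def)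
  moreover have "int N + 1 \<notin> insert (- int N - 1) (ints_below (Suc N))" "- int N - 1 \<notin> ints_below (Suc N)"
    by (auto simp: ints_below_def)
  moreover have "h (- int N - 1) = h (- 1 - int N)" by (rule arg_cong[where f = h]) simp
  ultimately show ?case using Suc by (simp add: algebra_simps)
qed

lemma tendsto_inverse_add_of_nat: "(\<lambda>N. 1 / (c + of_nat N :: complex)) \<longlonglongrightarrow> 0"
proof -
  have "filterlim (\<lambda>N. c + of_nat N :: complex) at_infinity sequentially"
    by (rule tendsto_add_filterlim_at_infinity[OF tendsto_const tendsto_of_nat])
  then have "(\<lambda>N. inverse (c + of_nat N :: complex)) \<longlonglongrightarrow> 0"
    by (rule filterlim_compose[OF tendsto_inverse_0])
  then show ?thesis by (simp add: inverse_eq_divide)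
qed

text \<open>
  With \<open>h(n) = 1 / (u + n - 1/2)\<close> the summand is \<open>h(n) - h(n + 1)\<close>, so that
  only two boundary terms survive.
\<close>

lemma telescoping_row_tendsto_0:
  fixes u :: complex
  assumes "\<And>n :: int. u + of_int n \<noteq> 1 / 2" "\<And>n :: int. u + of_int n \<noteq> - 1 / 2"
  shows "(\<lambda>N. \<Sum>n\<in>ints_below N. 1 / ((u + of_int n - 1 / 2) * (u + of_int n + 1 / 2))) \<longlonglongrightarrow> 0"
proof -
  define h where "h n = 1 / (u + of_int n - 1 / 2)" for n :: int
  have h: "1 / ((u + of_int n - 1 / 2) * (u + of_int n + 1 / 2)) = h n - h (n + 1)" for n
  proof -
    have "u + of_int n - 1 / 2 \<noteq> 0" "u + of_int n + 1 / 2 \<noteq> 0"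
      using assms[of n] by (simp_all add: eq_neg_iff_add_eq_0)
    moreover have "h (n + 1) = 1 / (u + of_int n + 1 / 2)"
      by (simp add: h_def algebra_simps)
    ultimately show ?thesis by (simp add: h_def field_simps)
  qed
  have "(\<lambda>N. - (1 / ((1 / 2 - u) + of_nat N)) - 1 / ((u + 1 / 2) + of_nat N)) \<longlonglongrightarrow> - 0 - 0"
    by (intro tendsto_diff tendsto_minus tendsto_inverse_add_of_nat)
  moreover have "h (- int N) = - (1 / ((1 / 2 - u) + of_nat N))" for N
    unfolding h_def minus_divide_right by (rule arg_cong[where f = "(/) 1"]) simp
  moreover have "h (int N + 1) = 1 / ((u + 1 / 2) + of_nat N)" for N
    unfolding h_def by (rule arg_cong[where f = "(/) 1"]) (simp add: field_simps)
  ultimately have "(\<lambda>N. h (- int N) - h (int N + 1)) \<longlonglongrightarrow> 0" by simp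
  then have "(\<lambda>N. \<Sum>n\<in>ints_below (Suc N). h n - h (n + 1)) \<longlonglongrightarrow> 0"
    by (simp add: sum_ints_below_telescope)
  then show ?thesis
    unfolding h by (rule LIMSEQ_imp_Suc)
qed

section \<open>Convergence and expansion tools\<close>

definition height :: "int \<times> int \<Rightarrow> real" where
  "height p = 1 + \<bar>real_of_int (fst p)\<bar> + \<bar>real_of_int (snd p)\<bar>"

lemma height_ge_1: "height p \<ge> 1"
  by (simp add: height_def)

text \<open>
  The height dominates both \<open>1 + \<bar>m\<bar>\<close> and \<open>1 + \<bar>n\<bar>\<close>, so its inverse cube is at most
  \<open>(1 + \<bar>m\<bar>)\<^bsup>-3/2\<^esup> (1 + \<bar>n\<bar>)\<^bsup>-3/2\<^esup>\<close>, a product of two convergent series.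
\<close>

lemma summable_height_cubed: "(\<lambda>p. 1 / height p ^ 3) summable_on UNIV"
proof -
  define g where "g n = (1 + \<bar>real_of_int n\<bar>) powr (-3/2)" for n
  have "summable (\<lambda>n. real (Suc n) powr (-3/2))"
    by (subst summable_Suc_iff) (simp add: summable_real_powr_iff)
  then have nat: "(\<lambda>n. real (Suc n) powr (-3/2)) summable_on UNIV"
    by (intro norm_summable_imp_summable_on) simp
  have "g summable_on range int" "g summable_on range (\<lambda>n. - int n)"
    by (subst summable_on_reindex; use nat in \<open>simp add: inj_def o_def g_def\<close>)+
  then have "g summable_on (range int \<union> range (\<lambda>n. - int n))" by (rule summable_on_union)
  moreover have "range int \<union> range (\<lambda>n. - int n) = UNIV"
    by (auto simp: image_def) (metis int_cases2)
  ultimately have g: "g summable_on UNIV" by simp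
  have "((\<lambda>n. g m * g n) has_sum (g m * infsum g UNIV)) UNIV" for m
    using g by (intro has_sum_cmult_right) simp
  then have "(\<lambda>p. g (fst p) * g (snd p)) summable_on (UNIV \<times> UNIV)"
    by (intro summable_on_SigmaI[where g = "\<lambda>m. g m * infsum g UNIV"] summable_on_cmult_left g)
       (auto simp: g_def)
  then have "(\<lambda>p. g (fst p) * g (snd p)) summable_on UNIV" by simp
  then show ?thesis
  proof (rule summable_on_comparison_test)
    fix p :: "int \<times> int"
    have "g (fst p) \<ge> height p powr (-3/2)" "g (snd p) \<ge> height p powr (-3/2)"
      unfolding g_def by (rule powr_mono2'; simp add: height_def)+
    then have "height p powr (-3/2) * height p powr (-3/2) \<le> g (fst p) * g (snd p)"
      by (intro mult_mono) (auto simp: g_def)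
    also have "height p powr (-3/2) * height p powr (-3/2) = 1 / height p ^ 3"
      using height_ge_1[of p] by (simp add: powr_add[symmetric] powr_minus_divide powr_numeral)
    finally show "1 / height p ^ 3 \<le> g (fst p) * g (snd p)" .
  qed (use height_ge_1 in \<open>auto intro!: divide_nonneg_nonneg simp: height_def\<close>)
qed

text \<open>
  Second order Taylor expansion, from the mean value inequality for \<open>f(z) - D z\<^sup>2 / 2\<close>, whose
  derivative is \<open>o(z)\<close>.
\<close>

lemma second_order_quotient_tendsto:
  fixes f f' :: "complex \<Rightarrow> complex"
  assumes f: "\<forall>\<^sub>F z in nhds 0. (f has_field_derivative f' z) (at z)"
    and f'0: "f' 0 = 0" and D: "(f' has_field_derivative D) (at 0)"
  shows "((\<lambda>z. (f z - f 0) / z ^ 2) \<longlongrightarrow> D / 2) (at 0)"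
proof (rule tendstoI)
  fix e :: real assume e: "e > 0"
  have "((\<lambda>z. f' z / z) \<longlongrightarrow> D) (at 0)"
    using D f'0 by (simp add: has_field_derivative_iff)
  then have "\<forall>\<^sub>F z in at 0. dist (f' z / z) D < e / 2"
    by (rule tendstoD) (use e in simp)
  then obtain d1 where d1: "d1 > 0" "\<And>z. z \<noteq> 0 \<Longrightarrow> dist z 0 < d1 \<Longrightarrow> dist (f' z / z) D < e / 2"
    unfolding eventually_at by auto
  obtain d2 where d2: "d2 > 0" "\<And>z. dist z 0 < d2 \<Longrightarrow> (f has_field_derivative f' z) (at z)"
    using f unfolding eventually_nhds_metric by auto
  have "dist ((f z - f 0) / z ^ 2) (D / 2) < e" if z: "z \<noteq> 0" "dist z 0 < min d1 d2" for z
  proof -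
    define \<phi> where "\<phi> w = f w - D / 2 * w ^ 2" for w
    have "norm (\<phi> z - \<phi> 0) \<le> (e / 2 * norm z) * norm (z - 0)"
    proof (rule field_differentiable_bound)
      show "convex (cball (0 :: complex) (norm z))" by simp
      fix w :: complex assume w: "w \<in> cball 0 (norm z)"
      have "(f has_field_derivative f' w) (at w)" using d2 w z by auto
      then have "(\<phi> has_field_derivative (f' w - D * w)) (at w)"
        unfolding \<phi>_def by (auto intro!: derivative_eq_intros)
      then show "(\<phi> has_field_derivative (f' w - D * w)) (at w within cball 0 (norm z))"
        by (rule has_field_derivative_at_within)
      show "norm (f' w - D * w) \<le> e / 2 * norm z"
      proof (cases "w = 0")
        case False
        have "norm (f' w / w - D) * norm w \<le> e / 2 * norm z"
          using d1(2)[of w] False w z e by (intro mult_mono) (auto simp: dist_norm)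
        also have "norm (f' w / w - D) * norm w = norm (f' w - D * w)"
          using False by (simp add: norm_mult[symmetric] left_diff_distrib)
        finally show ?thesis .
      qed (use f'0 e in simp)
    qed auto
    then have "norm (\<phi> z - \<phi> 0) \<le> e / 2 * norm z ^ 2" by (simp add: power2_eq_square)
    moreover have "(f z - f 0) / z ^ 2 - D / 2 = (\<phi> z - \<phi> 0) / z ^ 2"
      using z by (simp add: \<phi>_def field_simps)
    ultimately have "dist ((f z - f 0) / z ^ 2) (D / 2) \<le> e / 2"
      using z by (simp add: dist_norm norm_divide norm_power divide_le_eq)
    then show ?thesis using e by simp
  qed
  then show "\<forall>\<^sub>F z in at 0. dist ((f z - f 0) / z ^ 2) (D / 2) < e"
    unfolding eventually_at by (intro exI[of _ "min d1 d2"]) (use d1 d2 in auto)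
qed

section \<open>The lattice\<close>

locale upper_half_plane_point =
  fixes \<tau> :: complex
  assumes Im_tau: "Im \<tau> > 0"
begin

definition pt :: "int \<times> int \<Rightarrow> complex" where
  "pt p = of_int (fst p) * \<tau> + of_int (snd p)"

lemma pt_add: "pt (p + q) = pt p + pt q"
  by (simp add: pt_def algebra_simps)

lemma pt_minus: "pt (- p) = - pt p"
  by (simp add: pt_def)

lemma pt_zero [simp]: "pt (0, 0) = 0"
  by (simp add: pt_def)

lemma pt_inj: "inj pt"
proof (rule injI)
  fix p q assume eq: "pt p = pt q"
  from arg_cong[OF eq, of Im] have "fst p = fst q" using Im_tau by (simp add: pt_def)
  with eq show "p = q" by (simp add: pt_def prod_eq_iff)
qed

lemma range_pt: "range pt = period_lattice \<tau>"
  by (auto simp: pt_def period_lattice_def image_def)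

lemma pt_lower: "\<exists>c>0. \<forall>p. c * (\<bar>real_of_int (fst p)\<bar> + \<bar>real_of_int (snd p)\<bar>) \<le> norm (pt p)"
proof -
  define d where "d = 1 + (1 + norm \<tau>) / Im \<tau>"
  have d: "d > 0" using Im_tau by (auto simp: d_def intro!: add_pos_nonneg)
  have "\<bar>real_of_int (fst p)\<bar> + \<bar>real_of_int (snd p)\<bar> \<le> d * norm (pt p)" for p
  proof -
    let ?m = "real_of_int (fst p)" and ?n = "real_of_int (snd p)"
    have "\<bar>?m\<bar> * Im \<tau> \<le> norm (pt p)"
      using abs_Im_le_cmod[of "pt p"] Im_tau by (simp add: pt_def abs_mult)
    then have m: "\<bar>?m\<bar> \<le> norm (pt p) / Im \<tau>"
      using Im_tau by (simp add: pos_le_divide_eq)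
    have "\<bar>?n\<bar> = norm (pt p - of_int (fst p) * \<tau>)" by (simp add: pt_def)
    also have "\<dots> \<le> norm (pt p) + \<bar>?m\<bar> * norm \<tau>"
      using norm_triangle_ineq4[of "pt p" "of_int (fst p) * \<tau>"] by (simp add: norm_mult)
    finally have "\<bar>?n\<bar> \<le> norm (pt p) + \<bar>?m\<bar> * norm \<tau>" .
    then have "\<bar>?m\<bar> + \<bar>?n\<bar> \<le> norm (pt p) + \<bar>?m\<bar> * (1 + norm \<tau>)" by (simp add: algebra_simps)
    also have "\<dots> \<le> norm (pt p) + norm (pt p) / Im \<tau> * (1 + norm \<tau>)"
      using m by (intro add_left_mono mult_right_mono) auto
    finally show ?thesis by (simp add: d_def algebra_simps)
  qed
  then show ?thesis
    using d by (intro exI[of _ "1 / d"]) (auto simp: divide_le_eq mult.commute)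
qed

text \<open>
  The point \<open>pt p\<close> has size at least a multiple of the height, up to an additive error that depends
  on \<open>R\<close>. The lower bound \<open>\<delta>\<close> on the distance absorbs this error into the multiplicative
  constant, so that small and large lattice points need no separate treatment.
\<close>

lemma dist_pt_lower:
  assumes "\<delta> > 0" "R \<ge> 0"
  shows "\<exists>c>0. \<forall>u p. norm u \<le> R \<longrightarrow> \<delta> \<le> norm (u - pt p) \<longrightarrow> c * height p \<le> norm (u - pt p)"
proof -
  obtain c where c: "c > 0" "\<And>p. c * (\<bar>real_of_int (fst p)\<bar> + \<bar>real_of_int (snd p)\<bar>) \<le> norm (pt p)"
    using pt_lower by blast
  define K where "K = (c + R) / \<delta> + 1"
  have K: "K > 0" using c assms by (simp add: K_def add_nonneg_pos)
  \<comment> \<open>By the triangle inequality \<open>c height p \<le> c + R + dist\<close>, and \<open>c + R \<le> (c + R) / \<delta> * dist\<close>.\<close>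
  have "c / K * height p \<le> norm (u - pt p)" if u: "norm u \<le> R" "\<delta> \<le> norm (u - pt p)" for u p
  proof -
    have "c * height p \<le> c + norm (pt p)"
      using c(2)[of p] by (simp add: height_def algebra_simps)
    also have "norm (pt p) \<le> R + norm (u - pt p)"
      using norm_triangle_ineq4[of u "u - pt p"] u by simp
    also have "c + (R + norm (u - pt p)) = (c + R) / \<delta> * \<delta> + norm (u - pt p)"
      using assms by simp
    also have "\<dots> \<le> (c + R) / \<delta> * norm (u - pt p) + norm (u - pt p)"
      using u c assms by (intro add_right_mono mult_left_mono) auto
    finally have "c * height p \<le> K * norm (u - pt p)" by (simp add: K_def algebra_simps)
    then show ?thesis using K by (simp add: divide_le_eq mult.commute)
  qed
  then show ?thesis using c K by (intro exI[of _ "c / K"]) auto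
qed

lemma dist_half_pt: "min (1/2) (Im \<tau>) \<le> norm (1/2 - pt p)" "min (1/2) (Im \<tau>) \<le> norm (- 1/2 - pt p)"
proof -
  have *: "min (1/2) (Im \<tau>) \<le> norm (of_real s - pt p)" if s: "s = 1/2 \<or> s = - 1/2" for s :: real
  proof (cases "fst p = 0")
    case True
    have "of_real s - pt p = of_real (s - real_of_int (snd p))" using True by (simp add: pt_def)
    then have "norm (of_real s - pt p) = \<bar>s - real_of_int (snd p)\<bar>" by (simp only: norm_of_real)
    also have "\<dots> \<ge> 1/2"
    proof -
      have "2 * snd p \<le> 0 \<or> 2 * snd p \<ge> 2" "2 * snd p \<ge> 0 \<or> 2 * snd p \<le> -2" by presburger+
      then have "snd p \<le> 0 \<or> snd p \<ge> 1" "snd p \<ge> 0 \<or> snd p \<le> -1" by auto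
      then have "real_of_int (snd p) \<le> 0 \<or> real_of_int (snd p) \<ge> 1"
        "real_of_int (snd p) \<ge> 0 \<or> real_of_int (snd p) \<le> -1" by linarith+
      then show ?thesis using s by (auto simp: abs_if)
    qed
    finally show ?thesis by simp
  next
    case False
    then have "1 \<le> \<bar>real_of_int (fst p)\<bar>" by linarith
    then have "Im \<tau> \<le> \<bar>real_of_int (fst p)\<bar> * Im \<tau>" using Im_tau by simp
    also have "\<dots> = \<bar>Im (of_real s - pt p)\<bar>" using Im_tau by (simp add: pt_def abs_mult)
    also have "\<dots> \<le> norm (of_real s - pt p)" by (rule abs_Im_le_cmod)
    finally show ?thesis by simp
  qed
  show "min (1/2) (Im \<tau>) \<le> norm (1/2 - pt p)" using *[of "1/2"] by simp
  show "min (1/2) (Im \<tau>) \<le> norm (- 1/2 - pt p)" using *[of "-1/2"] by simp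
qed

lemma pt_neq_half: "pt p \<noteq> 1/2" "pt p \<noteq> - 1/2"
proof -
  have "0 < norm (1/2 - pt p)" "0 < norm (- 1/2 - pt p)"
    using dist_half_pt[of p] Im_tau by linarith+
  then show "pt p \<noteq> 1/2" "pt p \<noteq> - 1/2" by (metis diff_self norm_zero less_irrefl)+
qed

text \<open>
  The correction \<open>1 / (w\<^sup>2 - 1/4)\<close>. It agrees with \<open>1 / (z - w)\<^sup>2\<close> up to terms of order
  \<open>\<bar>w\<bar>\<^bsup>-3\<^esup>\<close>, has no pole at a lattice point, not even at \<open>0\<close>, telescopes along rows, and vanishes
  under differentiation, as it does not depend on \<open>z\<close>.
\<close>

definition reg :: "int \<times> int \<Rightarrow> complex" where
  "reg p = 1 / ((pt p - 1/2) * (pt p + 1/2))"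

text \<open>
  The shift by \<open>q\<close> serves to prove periodicity of the regularised series.
\<close>

lemma iter_lim_sum_reg: "iter_lim (\<lambda>M N. \<Sum>p\<in>ints_below M \<times> ints_below N. reg (p + q)) 0"
proof -
  have "(\<lambda>N. \<Sum>m\<in>ints_below M. \<Sum>n\<in>ints_below N. reg ((m, n) + q)) \<longlonglongrightarrow> (\<Sum>m\<in>ints_below M. 0)" for M
  proof (rule tendsto_sum)
    fix m
    define a where "a = pt ((m, 0) + q)"
    have eq: "pt ((m, n) + q) = a + of_int n" for n
      by (simp add: a_def pt_def algebra_simps)
    have "a + of_int n \<noteq> 1 / 2" "a + of_int n \<noteq> - 1 / 2" for n
      using pt_neq_half[of "(m, n) + q"] by (simp_all only: eq not_False_eq_True)
    then show "(\<lambda>N. \<Sum>n\<in>ints_below N. reg ((m, n) + q)) \<longlonglongrightarrow> 0"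
      unfolding reg_def eq by (rule telescoping_row_tendsto_0)
  qed
  then show ?thesis
    unfolding iter_lim_def by (intro exI[of _ "\<lambda>_. 0"]) (simp add: sum.cartesian_product')
qed

section \<open>Regularised lattice series\<close>

text \<open>
  The set \<open>A\<close> is the whole lattice or the lattice without \<open>0\<close>. The correction is subtracted also
  outside \<open>A\<close>, because it sums to \<open>0\<close> only over complete rows.
\<close>

definition lattice_term :: "(int \<times> int) set \<Rightarrow> nat \<Rightarrow> complex \<Rightarrow> int \<times> int \<Rightarrow> complex" where
  "lattice_term A j z p =
     (if p \<in> A then 1 / (z - pt p) ^ j else 0) - (if j = 2 then reg p else 0)"

definition lattice_series :: "(int \<times> int) set \<Rightarrow> nat \<Rightarrow> complex \<Rightarrow> complex" where
  "lattice_series A j z = infsum (lattice_term A j z) UNIV"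

text \<open>
  For exponents \<open>j \<ge> 3\<close> this is the lower bound on distances. For \<open>j = 2\<close> the leading terms
  cancel: the numerator of \<open>1 / (u - w)\<^sup>2 - 1 / (w\<^sup>2 - 1/4)\<close> is \<open>2 u w - u\<^sup>2 - 1/4\<close>, which is
  linear in \<open>w\<close>, over a denominator of degree four.
\<close>

lemma lattice_term_bound:
  assumes A: "- {(0, 0)} \<subseteq> A" and j: "2 \<le> j" and d: "\<delta> > 0" "R \<ge> 0"
  shows "\<exists>C. \<forall>u p. norm u \<le> R \<longrightarrow> (p \<in> A \<longrightarrow> \<delta> \<le> norm (u - pt p)) \<longrightarrow>
           norm (lattice_term A j u p) \<le> C * (1 / height p ^ 3)"
proof -
  obtain c where c: "c > 0"
      "\<And>u p. norm u \<le> R \<Longrightarrow> \<delta> \<le> norm (u - pt p) \<Longrightarrow> c * height p \<le> norm (u - pt p)"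
    using dist_pt_lower[OF d] by blast
  obtain c' where c': "c' > 0"
      "\<And>u p. norm u \<le> 1/2 \<Longrightarrow> min (1/2) (Im \<tau>) \<le> norm (u - pt p) \<Longrightarrow> c' * height p \<le> norm (u - pt p)"
    using dist_pt_lower[of "min (1/2) (Im \<tau>)" "1/2"] Im_tau by auto
  have c'1: "c' * height p \<le> norm (pt p - 1/2)" for p
    using c'(2)[of "1/2" p] dist_half_pt[of p] by (simp add: norm_minus_commute)
  have c'2: "c' * height p \<le> norm (pt p + 1/2)" for p
  proof -
    have "c' * height p \<le> norm (- 1/2 - pt p)" by (rule c'(2)) (use dist_half_pt[of p] in simp_all)
    also have "- 1/2 - pt p = - (pt p + 1/2)" by simp
    finally show ?thesis by (simp only: norm_minus_cancel)
  qed
  define K where "K = 2 * R * (norm \<tau> + 1) + R\<^sup>2 + 1/4"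
  have K: "norm (2 * u * pt p - u\<^sup>2 - 1/4) \<le> K * height p" if u: "norm u \<le> R" for u p
  proof -
    have "norm (pt p) \<le> \<bar>real_of_int (fst p)\<bar> * norm \<tau> + \<bar>real_of_int (snd p)\<bar>"
      using norm_triangle_ineq[of "of_int (fst p) * \<tau>" "of_int (snd p)"] by (simp add: pt_def norm_mult)
    also have "\<dots> \<le> height p * norm \<tau> + height p"
      by (intro add_mono mult_right_mono) (auto simp: height_def)
    finally have w: "norm (pt p) \<le> (norm \<tau> + 1) * height p" by (simp add: algebra_simps)
    have "norm (2 * u * pt p - u\<^sup>2 - 1/4) \<le> norm (2 * u * pt p) + norm (u\<^sup>2) + norm (1/4 :: complex)"
      by (meson add_right_mono norm_triangle_ineq4 order_trans)
    also have "\<dots> = 2 * norm u * norm (pt p) + (norm u)\<^sup>2 * 1 + 1/4 * 1"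
      by (simp add: norm_mult norm_power)
    also have "\<dots> \<le> 2 * R * ((norm \<tau> + 1) * height p) + R\<^sup>2 * height p + 1/4 * height p"
      using u w d height_ge_1[of p] by (intro add_mono mult_mono) auto
    finally show ?thesis by (simp add: K_def algebra_simps)
  qed
  have K0: "K \<ge> 0" using d by (simp add: K_def)
  define C where "C = 4 + 1 / c ^ j + K / (c\<^sup>2 * c'\<^sup>2)"
  have "norm (lattice_term A j u p) \<le> C * (1 / height p ^ 3)"
    if u: "norm u \<le> R" and far: "p \<in> A \<Longrightarrow> \<delta> \<le> norm (u - pt p)" for u p
  proof (cases "p \<in> A")
    case False
    \<comment> \<open>Here only the correction is left, and \<open>reg (0, 0) = -4\<close>; this accounts for the summand \<open>4\<close> in \<open>C\<close>.\<close>
    then have "p = (0, 0)" using A by auto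
    then show ?thesis
      using False c c' K0 by (simp add: lattice_term_def reg_def height_def C_def norm_divide)
  next
    case True
    have h: "height p \<ge> 1" by (rule height_ge_1)
    have w: "c * height p \<le> norm (u - pt p)" using c(2) u far True by blast
    have wp: "0 < c * height p" using c(1) h by (intro mult_pos_pos) auto
    then have "norm (u - pt p) \<noteq> 0" using w by linarith
    then have nz: "u - pt p \<noteq> 0" by simp
    show ?thesis
    proof (cases "j = 2")
      case False
      then have "norm (lattice_term A j u p) = 1 / norm (u - pt p) ^ j"
        using True by (simp add: lattice_term_def norm_divide norm_power)
      also have "\<dots> \<le> 1 / (c * height p) ^ j"
        using w wp by (intro frac_le power_mono zero_less_power) auto
      also have "\<dots> = 1 / c ^ j * (1 / height p ^ j)" by (simp add: power_mult_distrib)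
      also have "\<dots> \<le> C * (1 / height p ^ 3)"
      proof (intro mult_mono)
        show "1 / height p ^ j \<le> 1 / height p ^ 3"
          using h j False by (intro divide_left_mono power_increasing) auto
        show "1 / c ^ j \<le> C" "0 \<le> C" using c c' K0 by (auto simp: C_def)
      qed (use h in auto)
      finally show ?thesis .
    next
      case j2: True
      have half: "pt p - 1/2 \<noteq> 0" "pt p + 1/2 \<noteq> 0"
        using pt_neq_half[of p] by (auto simp: eq_neg_iff_add_eq_0)
      have "lattice_term A j u p =
          (2 * u * pt p - u\<^sup>2 - 1/4) / ((u - pt p)\<^sup>2 * ((pt p - 1/2) * (pt p + 1/2)))"
      proof -
        have "lattice_term A j u p =
            ((pt p - 1/2) * (pt p + 1/2) - (u - pt p)\<^sup>2) / ((u - pt p)\<^sup>2 * ((pt p - 1/2) * (pt p + 1/2)))"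
        proof -
          have "1 / a - 1 / b = (b - a) / (a * b)" if "a \<noteq> 0" "b \<noteq> 0" for a b :: complex
            using that by (simp add: field_simps)
          from this[of "(u - pt p)\<^sup>2" "(pt p - 1/2) * (pt p + 1/2)"] show ?thesis
            using True j2 nz half unfolding lattice_term_def reg_def by simp
        qed
        also have "(pt p - 1/2) * (pt p + 1/2) - (u - pt p)\<^sup>2 = 2 * u * pt p - u\<^sup>2 - 1/4"
          by (simp add: algebra_simps power2_eq_square)
        finally show ?thesis .
      qed
      then have "norm (lattice_term A j u p) = norm (2 * u * pt p - u\<^sup>2 - 1/4) /
          ((norm (u - pt p))\<^sup>2 * (norm (pt p - 1/2) * norm (pt p + 1/2)))"
        by (simp add: norm_divide norm_mult norm_power)
      also have "\<dots> \<le> K * height p / ((c * height p)\<^sup>2 * ((c' * height p) * (c' * height p)))"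
      proof (rule frac_le)
        show "0 \<le> K * height p" using K0 h by simp
        show "0 < (c * height p)\<^sup>2 * ((c' * height p) * (c' * height p))"
          using c c' h by (intro mult_pos_pos zero_less_power) auto
        show "(c * height p)\<^sup>2 * ((c' * height p) * (c' * height p))
            \<le> (norm (u - pt p))\<^sup>2 * (norm (pt p - 1/2) * norm (pt p + 1/2))"
          using c c' h w wp by (intro mult_mono power_mono c'1 c'2) auto
      qed (use K u in auto)
      also have "\<dots> = K / (c\<^sup>2 * c'\<^sup>2) * (1 / height p ^ 3)"
        using h c c' by (simp add: field_simps power2_eq_square power3_eq_cube)
      also have "\<dots> \<le> C * (1 / height p ^ 3)"
        using h c c' by (intro mult_right_mono) (auto simp: C_def)
      finally show ?thesis .
    qed
  qed
  then show ?thesis by blast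
qed

text \<open>
  Only finitely many lattice points lie within distance \<open>1\<close> of \<open>z\<close>.
\<close>

lemma pt_separated:
  assumes "z \<notin> pt ` A"
  shows "\<exists>\<delta>>0. \<forall>u\<in>cball z \<delta>. \<forall>p\<in>A. \<delta> \<le> norm (u - pt p)"
proof -
  define B where "B = {p \<in> A. norm (z - pt p) < 1}"
  obtain c where c: "c > 0" "\<And>p. c * (\<bar>real_of_int (fst p)\<bar> + \<bar>real_of_int (snd p)\<bar>) \<le> norm (pt p)"
    using pt_lower by blast
  define k where "k = \<lceil>(norm z + 1) / c\<rceil>"
  have "B \<subseteq> {-k..k} \<times> {-k..k}"
  proof
    fix p assume "p \<in> B"
    then have "norm (pt p) \<le> norm z + 1"
      using norm_triangle_ineq2[of "pt p" z] by (auto simp: B_def norm_minus_commute)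
    then have "\<bar>real_of_int (fst p)\<bar> + \<bar>real_of_int (snd p)\<bar> \<le> (norm z + 1) / c"
      using c(1) c(2)[of p] by (simp add: pos_le_divide_eq mult.commute)
    then have "real_of_int \<bar>fst p\<bar> \<le> real_of_int k" "real_of_int \<bar>snd p\<bar> \<le> real_of_int k"
      unfolding k_def by linarith+
    then have "\<bar>fst p\<bar> \<le> k" "\<bar>snd p\<bar> \<le> k" by (simp_all only: of_int_le_iff)
    then show "p \<in> {-k..k} \<times> {-k..k}" by (auto simp: mem_Times_iff abs_le_iff)
  qed
  then have fin: "finite B" by (rule finite_subset) auto
  define d where "d = Min (insert 1 ((\<lambda>p. norm (z - pt p)) ` B))"
  have d: "d > 0" using fin assms unfolding d_def by (subst Min_gr_iff) (auto simp: B_def)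
  have far: "d \<le> norm (z - pt p)" if "p \<in> A" for p
  proof (cases "p \<in> B")
    case True
    then show ?thesis unfolding d_def by (intro Min_le) (use fin in auto)
  next
    case False
    have "d \<le> 1" unfolding d_def by (intro Min_le) (use fin in auto)
    then show ?thesis using False that by (auto simp: B_def)
  qed
  have "d / 2 \<le> norm (u - pt p)" if "u \<in> cball z (d/2)" "p \<in> A" for u p
  proof -
    have "norm (z - pt p) \<le> norm (z - u) + norm (u - pt p)"
      using norm_triangle_ineq[of "z - u" "u - pt p"] by simp
    then show ?thesis using far[OF that(2)] that(1) by (simp add: dist_norm)
  qed
  then show ?thesis using d by (intro exI[of _ "d/2"]) auto
qed

lemma lattice_term_local_bound:
  assumes "- {(0, 0)} \<subseteq> A" "2 \<le> j" "z \<notin> pt ` A"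
  shows "\<exists>\<delta>>0. \<exists>C. \<forall>u\<in>cball z \<delta>.
           (\<forall>p. norm (lattice_term A j u p) \<le> C * (1 / height p ^ 3)) \<and> u \<notin> pt ` A"
proof -
  obtain \<delta> where d: "\<delta> > 0" "\<And>u p. u \<in> cball z \<delta> \<Longrightarrow> p \<in> A \<Longrightarrow> \<delta> \<le> norm (u - pt p)"
    using pt_separated[OF assms(3)] by blast
  obtain C where C: "\<And>u p. norm u \<le> norm z + \<delta> \<Longrightarrow> (p \<in> A \<Longrightarrow> \<delta> \<le> norm (u - pt p)) \<Longrightarrow>
       norm (lattice_term A j u p) \<le> C * (1 / height p ^ 3)"
    using lattice_term_bound[OF assms(1,2) d(1), of "norm z + \<delta>"] d(1) by auto
  have "norm u \<le> norm z + \<delta>" if "u \<in> cball z \<delta>" for u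
    using that norm_triangle_ineq2[of u z] by (simp add: dist_norm norm_minus_commute)
  moreover have "u \<notin> pt ` A" if "u \<in> cball z \<delta>" for u
    using d(2)[OF that] d(1) by force
  ultimately show ?thesis using C d by blast
qed

lemma lattice_series_has_sum:
  assumes "- {(0, 0)} \<subseteq> A" "2 \<le> j" "z \<notin> pt ` A"
  shows "(lattice_term A j z has_sum lattice_series A j z) UNIV"
proof -
  obtain C where C: "\<And>p. norm (lattice_term A j z p) \<le> C * (1 / height p ^ 3)"
    using lattice_term_local_bound[OF assms] by (metis centre_in_cball less_imp_le)
  have "(\<lambda>p. norm (lattice_term A j z p)) summable_on UNIV"
    by (rule Infinite_Sum.abs_summable_on_comparison_test'[OF summable_on_cmult_right[OF summable_height_cubed, of C]])
       (rule C)
  then have "lattice_term A j z summable_on UNIV" by (rule abs_summable_summable)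
  then show ?thesis unfolding lattice_series_def by (rule has_sum_infsum)
qed

text \<open>
  Termwise differentiation, by the uniform bound and Weierstrass' theorem. The exponent on the
  right is at least three, where no correction is present.
\<close>

lemma lattice_series_deriv:
  assumes "- {(0, 0)} \<subseteq> A" "2 \<le> j" "z \<notin> pt ` A"
  shows "(lattice_series A j has_field_derivative - of_nat j * lattice_series A (Suc j) z) (at z)"
proof -
  obtain \<delta> C where d: "\<delta> > 0"
      "\<And>u p. u \<in> cball z \<delta> \<Longrightarrow> norm (lattice_term A j u p) \<le> C * (1 / height p ^ 3)"
      "\<And>u. u \<in> cball z \<delta> \<Longrightarrow> u \<notin> pt ` A"
    using lattice_term_local_bound[OF assms] by blast
  have trm: "((\<lambda>u. lattice_term A j u p) has_field_derivative - of_nat j * lattice_term A (Suc j) u p) (at u)"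
    if u: "u \<in> cball z \<delta>" for u p
  proof (cases "p \<in> A")
    case True
    then have nz: "u - pt p \<noteq> 0" using d(3)[OF u] by auto
    obtain i where i: "j = Suc i" using assms(2) by (cases j) auto
    have "((\<lambda>u. 1 / (u - pt p) ^ j - (if j = 2 then reg p else 0)) has_field_derivative
        - of_nat j * (1 / (u - pt p) ^ Suc j)) (at u)"
      unfolding i
      by (rule DERIV_cong[OF DERIV_diff[OF DERIV_divide[OF DERIV_const
            DERIV_power[OF DERIV_diff[OF DERIV_ident DERIV_const]]] DERIV_const]])
         (use nz in \<open>simp_all add: divide_simps\<close>)
    moreover have "Suc j \<noteq> 2" using assms(2) by simp
    ultimately show ?thesis using True unfolding lattice_term_def by simp
  next
    case False
    then show ?thesis using assms(2) unfolding lattice_term_def by simp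
  qed
  have ul: "uniform_limit (cball z \<delta>) (\<lambda>X u. \<Sum>p\<in>X. lattice_term A j u p)
      (lattice_series A j) (finite_subsets_at_top UNIV)"
    unfolding lattice_series_def
    by (rule Weierstrass_m_test_general[where M = "\<lambda>p. C * (1 / height p ^ 3)"])
       (use d(2) in \<open>auto intro!: summable_on_cmult_right[OF summable_height_cubed, of C, simplified]\<close>)
  have sums: "((\<lambda>u. \<Sum>p\<in>X. lattice_term A j u p) has_field_derivative
      (\<Sum>p\<in>X. - of_nat j * lattice_term A (Suc j) u p)) (at u)" if "u \<in> cball z \<delta>" for X u
    by (intro DERIV_sum trm that)
  then have "continuous_on (cball z \<delta>) (\<lambda>u. \<Sum>p\<in>X. lattice_term A j u p)" for X
    by (intro DERIV_continuous_on[where D = "\<lambda>u. \<Sum>p\<in>X. - of_nat j * lattice_term A (Suc j) u p"])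
       (auto intro: has_field_derivative_at_within)
  with sums have ev: "\<forall>\<^sub>F X in finite_subsets_at_top UNIV.
      continuous_on (cball z \<delta>) (\<lambda>u. \<Sum>p\<in>X. lattice_term A j u p) \<and>
      (\<forall>u\<in>ball z \<delta>. ((\<lambda>u. \<Sum>p\<in>X. lattice_term A j u p) has_field_derivative
         (\<Sum>p\<in>X. - of_nat j * lattice_term A (Suc j) u p)) (at u))"
    by (intro always_eventually allI conjI) (auto simp: ball_def)
  obtain g' where g': "\<And>u. u \<in> ball z \<delta> \<Longrightarrow> (lattice_series A j has_field_derivative g' u) (at u) \<and>
      ((\<lambda>X. \<Sum>p\<in>X. - of_nat j * lattice_term A (Suc j) u p) \<longlongrightarrow> g' u) (finite_subsets_at_top UNIV)"
    using has_complex_derivative_uniform_limit[OF ev ul _ d(1)] by (metis finite_subsets_at_top_neq_bot)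
  have "((\<lambda>p. - of_nat j * lattice_term A (Suc j) z p) has_sum - of_nat j * lattice_series A (Suc j) z) UNIV"
    by (intro has_sum_cmult_right lattice_series_has_sum) (use assms in auto)
  then have "g' z = - of_nat j * lattice_series A (Suc j) z"
    using g'[of z] d(1) unfolding has_sum_def by (auto intro: tendsto_unique[rotated])
  then show ?thesis using g'[of z] d(1) by auto
qed

section \<open>Multiple Weierstrass functions and Eisenstein series as lattice series\<close>

lemma iter_lim_power_sum:
  assumes "- {(0, 0)} \<subseteq> A" "2 \<le> j" "z \<notin> pt ` A"
  shows "iter_lim (\<lambda>M N. \<Sum>p\<in>ints_below M \<times> ints_below N \<inter> A. 1 / (z - pt p) ^ j) (lattice_series A j z)"
proof -
  let ?B = "\<lambda>M N. ints_below M \<times> ints_below N"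
  have "iter_lim (\<lambda>M N. \<Sum>p\<in>?B M N. if j = 2 then reg p else 0) 0"
    using iter_lim_sum_reg[of 0] by (cases "j = 2") (auto simp: iter_lim_def)
  from iter_lim_add[OF has_sum_imp_iter_lim[OF lattice_series_has_sum[OF assms]] this]
  have "iter_lim (\<lambda>M N. \<Sum>p\<in>?B M N. if p \<in> A then 1 / (z - pt p) ^ j else 0) (lattice_series A j z)"
    unfolding sum.distrib[symmetric] by (simp add: lattice_term_def)
  then show ?thesis by (simp add: sum.inter_restrict)
qed

lemma iter_lim_newton_power_sums:
  assumes "- {(0, 0)} \<subseteq> A" "z \<notin> pt ` A"
  shows "iter_lim (\<lambda>M N. newton_elem (\<lambda>k. \<Sum>p\<in>ints_below M \<times> ints_below N \<inter> A. (1 / (z - pt p)\<^sup>2) ^ k) n)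
           (newton_elem (\<lambda>k. lattice_series A (2 * k) z) n)"
proof (rule iter_lim_newton_elem)
  fix k :: nat assume "1 \<le> k"
  then show "iter_lim (\<lambda>M N. \<Sum>p\<in>ints_below M \<times> ints_below N \<inter> A. (1 / (z - pt p)\<^sup>2) ^ k)
      (lattice_series A (2 * k) z)"
    using iter_lim_power_sum[OF assms(1) _ assms(2), of "2 * k"]
    by (simp add: power_one_over power_mult[symmetric] divide_inverse power_inverse)
qed

lemma lattice_box_eq: "lattice_box \<tau> M N = pt ` (ints_below M \<times> ints_below N)"
  by (auto simp: lattice_box_def pt_def image_def)

lemma lattice_less_pt:
  "lattice_less \<tau> (pt p) (pt q) \<longleftrightarrow> fst p < fst q \<or> (fst p = fst q \<and> snd p < snd q)"
proof
  assume "lattice_less \<tau> (pt p) (pt q)"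
  then obtain m1 n1 m2 n2 where *: "pt p = pt (m1, n1)" "pt q = pt (m2, n2)"
      "m1 < m2 \<or> (m1 = m2 \<and> n1 < n2)"
    unfolding lattice_less_def by (auto simp: pt_def)
  then show "fst p < fst q \<or> (fst p = fst q \<and> snd p < snd q)"
    using injD[OF pt_inj *(1)] injD[OF pt_inj *(2)] by auto
next
  assume "fst p < fst q \<or> (fst p = fst q \<and> snd p < snd q)"
  then show "lattice_less \<tau> (pt p) (pt q)"
    unfolding lattice_less_def pt_def by blast
qed

text \<open>
  In each finite box the chain sum is a coefficient of a product, hence given by Newton's recursion
  from power sums; then the limits are taken in the power sums.
\<close>

lemma multiple_wp_eq_newton:
  assumes z: "z \<notin> period_lattice \<tau>"
  shows "multiple_wp (replicate r 2) z \<tau> = newton_elem (\<lambda>k. lattice_series UNIV (2 * k) z) r"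
proof -
  have finite_sum: "(\<Sum>ws\<in>lattice_chains \<tau> r M N. 1 / (\<Prod>i<r. (z - ws ! i) ^ (replicate r 2 ! i))) =
      newton_elem (\<lambda>k. \<Sum>p\<in>ints_below M \<times> ints_below N. (1 / (z - pt p)\<^sup>2) ^ k) r" for M N
  proof -
    let ?S = "lattice_box \<tau> M N" and ?f = "\<lambda>w. 1 / (z - w)\<^sup>2"
    have fin: "finite ?S" by (simp add: lattice_box_eq)
    have "(\<Sum>ws\<in>lattice_chains \<tau> r M N. 1 / (\<Prod>i<r. (z - ws ! i) ^ (replicate r 2 ! i))) =
        (\<Sum>ws | length ws = r \<and> set ws \<subseteq> ?S \<and> sorted_wrt (lattice_less \<tau>) ws. prod_list (map ?f ws))"
      unfolding lattice_chains_def
    proof (rule sum.cong)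
      fix ws :: "complex list"
      assume "ws \<in> {ws. length ws = r \<and> set ws \<subseteq> ?S \<and> sorted_wrt (lattice_less \<tau>) ws}"
      then have "length ws = r" by simp
      then show "1 / (\<Prod>i<r. (z - ws ! i) ^ (replicate r 2 ! i)) = prod_list (map ?f ws)"
        by (simp add: prod.list_conv_set_nth prod_dividef atLeast0LessThan)
    qed simp
    also have "\<dots> = (\<Prod>w\<in>?S. 1 + fps_const (?f w) * fps_X) $ r"
    proof (rule sum_chains_eq_coeff[OF fin])
      show "transp_on ?S (lattice_less \<tau>)" "asymp_on ?S (lattice_less \<tau>)" "totalp_on ?S (lattice_less \<tau>)"
        unfolding lattice_box_eq transp_on_def asymp_on_def totalp_on_def
        by (auto simp: lattice_less_pt) (metis linorder_less_linear)
    qed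
    also have "\<dots> = newton_elem (\<lambda>k. \<Sum>w\<in>?S. ?f w ^ k) r"
      by (simp flip: newton_fps_power_sums[OF fin])
    also have "(\<lambda>k. \<Sum>w\<in>?S. ?f w ^ k) = (\<lambda>k. \<Sum>p\<in>ints_below M \<times> ints_below N. ?f (pt p) ^ k)"
      unfolding lattice_box_eq by (subst sum.reindex) (auto intro: inj_on_subset[OF pt_inj])
    finally show ?thesis .
  qed
  have "iter_lim (\<lambda>M N. newton_elem (\<lambda>k. \<Sum>p\<in>ints_below M \<times> ints_below N. (1 / (z - pt p)\<^sup>2) ^ k) r)
      (newton_elem (\<lambda>k. lattice_series UNIV (2 * k) z) r)"
    using iter_lim_newton_power_sums[of UNIV z r] z by (simp add: range_pt)
  then show ?thesis
    unfolding multiple_wp_def length_replicate finite_sum by (rule iter_lim_unique)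
qed

abbreviation punctured :: "(int \<times> int) set" where "punctured \<equiv> - {(0, 0)}"

lemma pt_punctured: "pt ` punctured = range pt - {0}"
  by (simp add: Compl_eq_Diff_UNIV image_set_diff[OF pt_inj])

lemma zero_notin_punctured: "0 \<notin> pt ` punctured"
  by (simp add: pt_punctured)

lemma eisenstein_G_eq:
  assumes "1 \<le> k"
  shows "eisenstein_G (2 * k) \<tau> = lattice_series punctured (2 * k) 0"
proof -
  have "iter_lim (\<lambda>M N. \<Sum>p\<in>ints_below M \<times> ints_below N \<inter> punctured. 1 / (0 - pt p) ^ (2 * k))
      (lattice_series punctured (2 * k) 0)"
    by (rule iter_lim_power_sum) (use assms zero_notin_punctured in auto)
  moreover have "(0 - pt p) ^ (2 * k) = pt p ^ (2 * k)" for p by simp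
  ultimately have "iter_lim (\<lambda>M N. \<Sum>(m, n)\<in>ints_below M \<times> ints_below N - {(0, 0)}.
      1 / (of_int m * \<tau> + of_int n) ^ (2 * k)) (lattice_series punctured (2 * k) 0)"
    by (simp only: pt_def case_prod_unfold Diff_eq)
  then show ?thesis
    using assms by (simp add: eisenstein_G_def iter_lim_unique)
qed

section \<open>Periodicity and behaviour at the origin\<close>

lemma lattice_series_UNIV:
  assumes "z \<notin> range pt" "2 \<le> j"
  shows "lattice_series UNIV j z = lattice_series punctured j z + 1 / z ^ j"
proof -
  have z: "z \<notin> pt ` punctured" using assms by auto
  have "((\<lambda>p. if p = (0, 0) then 1 / z ^ j else 0) has_sum 1 / z ^ j) UNIV"
    by (rule has_sum_finite_neutralI[of "{(0, 0)}"]) auto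
  from has_sum_add[OF lattice_series_has_sum[OF subset_refl assms(2) z] this]
  have "((\<lambda>p. lattice_term punctured j z p + (if p = (0, 0) then 1 / z ^ j else 0)) has_sum
      lattice_series punctured j z + 1 / z ^ j) UNIV" .
  moreover have "lattice_term punctured j z p + (if p = (0, 0) then 1 / z ^ j else 0) =
      lattice_term UNIV j z p" for p
    by (auto simp: lattice_term_def)
  ultimately show ?thesis
    using lattice_series_has_sum[of UNIV j z] assms by (simp add: has_sum_unique)
qed

lemma shift_mem_lattice: "z + pt q \<in> range pt \<longleftrightarrow> z \<in> range pt"
proof
  assume "z + pt q \<in> range pt"
  then obtain p where "z + pt q = pt p" by auto
  then have "z = pt (p + - q)" by (simp only: pt_add pt_minus) (simp add: eq_diff_eq)
  then show "z \<in> range pt" by blast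
next
  assume "z \<in> range pt"
  then obtain p where "z = pt p" by auto
  then have "z + pt q = pt (p + q)" by (simp add: pt_add)
  then show "z + pt q \<in> range pt" by blast
qed

text \<open>
  Reindexing by \<open>q\<close> leaves only the difference of the corrections \<open>reg p - reg (p + q)\<close>. The sum of
  these converges absolutely, and its value is \<open>0\<close>, because both parts have iterated limit \<open>0\<close>.
\<close>

lemma lattice_series_periodic:
  assumes "z \<notin> range pt" "2 \<le> j"
  shows "lattice_series UNIV j (z + pt q) = lattice_series UNIV j z"
proof -
  let ?c = "\<lambda>p. if j = 2 then reg p - reg (p + q) else 0"
  have zq: "z + pt q \<notin> range pt" using assms(1) by (simp add: shift_mem_lattice)
  have "bij (\<lambda>p. p + q)" by (rule bij_betwI[where g = "\<lambda>p. p - q"]) auto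
  then have "((\<lambda>p. lattice_term UNIV j (z + pt q) (p + q)) has_sum lattice_series UNIV j (z + pt q)) UNIV"
    using lattice_series_has_sum[of UNIV j "z + pt q"] zq assms(2)
    by (subst has_sum_reindex_bij_betw[where f = "lattice_term UNIV j (z + pt q)"]) auto
  from has_sum_add[OF this has_sum_uminusI[OF lattice_series_has_sum[of UNIV j z]]]
  have "((\<lambda>p. lattice_term UNIV j (z + pt q) (p + q) - lattice_term UNIV j z p) has_sum
      lattice_series UNIV j (z + pt q) - lattice_series UNIV j z) UNIV"
    using assms by simp
  moreover have "lattice_term UNIV j (z + pt q) (p + q) - lattice_term UNIV j z p = ?c p" for p
    by (simp add: lattice_term_def pt_add)
  ultimately have "(?c has_sum lattice_series UNIV j (z + pt q) - lattice_series UNIV j z) UNIV"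
    by simp
  from has_sum_imp_iter_lim[OF this]
  have L: "iter_lim (\<lambda>M N. \<Sum>p\<in>ints_below M \<times> ints_below N. ?c p)
      (lattice_series UNIV j (z + pt q) - lattice_series UNIV j z)" .
  have "iter_lim (\<lambda>M N. \<Sum>p\<in>ints_below M \<times> ints_below N. ?c p) 0"
  proof (cases "j = 2")
    case True
    from iter_lim_sum_reg[of q] have "iter_lim (\<lambda>M N. - (\<Sum>p\<in>ints_below M \<times> ints_below N. reg (p + q))) 0"
      using iter_lim_uminus by fastforce
    from iter_lim_add[OF iter_lim_sum_reg[of 0] this] show ?thesis
      using True by (simp add: sum_subtractf)
  qed (auto simp: iter_lim_def)
  from iter_lim_unique[OF L] iter_lim_unique[OF this] show ?thesis by simp
qed

lemma lattice_series_odd_at_0: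
  assumes "odd j"
  shows "lattice_series punctured j 0 = 0"
proof -
  have "bij_betw uminus (UNIV :: (int \<times> int) set) UNIV" by (rule bij_betwI[where g = uminus]) auto
  then have "lattice_series punctured j 0 = infsum (\<lambda>p. lattice_term punctured j 0 (- p)) UNIV"
    unfolding lattice_series_def by (rule infsum_reindex_bij_betw[symmetric])
  also have "(\<lambda>p. lattice_term punctured j 0 (- p)) = (\<lambda>p. - lattice_term punctured j 0 p)"
  proof
    fix p :: "int \<times> int"
    have "j \<noteq> 2" using assms by auto
    moreover have "- p = (0, 0) \<longleftrightarrow> p = (0, 0)" by (cases p) auto
    ultimately show "lattice_term punctured j 0 (- p) = - lattice_term punctured j 0 p"
      using assms by (simp add: lattice_term_def pt_minus)
  qed
  also have "infsum \<dots> UNIV = - lattice_series punctured j 0"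
    by (simp add: infsum_uminus lattice_series_def)
  finally show ?thesis by simp
qed

lemma lattice_series_holomorphic:
  assumes "- {(0, 0)} \<subseteq> A" "2 \<le> j"
  shows "lattice_series A j holomorphic_on - (pt ` A)"
proof (rule holomorphic_onI)
  fix z assume "z \<in> - (pt ` A)"
  then have "lattice_series A j field_differentiable (at z)"
    using lattice_series_deriv[OF assms] by (auto simp: field_differentiable_def)
  then show "lattice_series A j field_differentiable (at z within - (pt ` A))"
    by (rule field_differentiable_at_within)
qed

lemma open_compl_pt: "open (- (pt ` A))"
  unfolding open_contains_cball
proof
  fix z assume "z \<in> - (pt ` A)"
  then obtain \<delta> where "\<delta> > 0" "\<forall>u\<in>cball z \<delta>. \<forall>p\<in>A. \<delta> \<le> norm (u - pt p)"
    using pt_separated[of z A] by auto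
  then show "\<exists>e>0. cball z e \<subseteq> - pt ` A" by (intro exI[of _ \<delta>]) force
qed

text \<open>
  Differentiating twice gives the factor \<open>2k (2k + 1)\<close>; the linear term vanishes by oddness.
\<close>

lemma lattice_series_quadratic_coeff:
  assumes "1 \<le> k"
  shows "((\<lambda>z. (lattice_series punctured (2 * k) z - lattice_series punctured (2 * k) 0) / z\<^sup>2) \<longlongrightarrow>
           of_nat k * (2 * of_nat k + 1) * lattice_series punctured (2 * k + 2) 0) (at 0)"
proof -
  let ?f' = "\<lambda>z. - of_nat (2 * k) * lattice_series punctured (2 * k + 1) z"
  have "\<forall>\<^sub>F z in nhds 0. (z :: complex) \<in> - pt ` punctured"
    by (rule eventually_nhds_in_open[OF open_compl_pt]) (use zero_notin_punctured in auto)
  then have "\<forall>\<^sub>F z in nhds 0. (lattice_series punctured (2 * k) has_field_derivative ?f' z) (at z)"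
    by eventually_elim (use lattice_series_deriv[of punctured "2 * k"] assms in auto)
  moreover have "?f' 0 = 0" using lattice_series_odd_at_0[of "2 * k + 1"] by simp
  moreover have "(?f' has_field_derivative - of_nat (2 * k) *
      (- of_nat (2 * k + 1) * lattice_series punctured (2 * k + 2) 0)) (at 0)"
    using lattice_series_deriv[of punctured "2 * k + 1" 0] zero_notin_punctured assms
    by (intro DERIV_cmult) simp
  ultimately have "((\<lambda>z. (lattice_series punctured (2 * k) z - lattice_series punctured (2 * k) 0) / z\<^sup>2) \<longlongrightarrow>
      - of_nat (2 * k) * (- of_nat (2 * k + 1) * lattice_series punctured (2 * k + 2) 0) / 2) (at 0)"
    by (rule second_order_quotient_tendsto)
  moreover have "- of_nat (2 * k) * (- of_nat (2 * k + 1) * G) / 2 = of_nat k * (2 * of_nat k + 1) * G"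
    for G :: complex
    by (simp add: field_simps)
  ultimately show ?thesis by (simp only:)
qed

text \<open>
  For \<open>k \<ge> 1\<close> this is the Eisenstein series of weight \<open>2k\<close>; the convention \<open>G\<^sub>0 = -1\<close> is not
  built in.
\<close>

abbreviation G :: "nat \<Rightarrow> complex" where
  "G k \<equiv> lattice_series punctured (2 * k) 0"

abbreviation punctured_elem :: "nat \<Rightarrow> complex \<Rightarrow> complex" where
  "punctured_elem n z \<equiv> newton_elem (\<lambda>k. lattice_series punctured (2 * k) z) n"

lemma coeff_f_eq: "coeff_f (Suc n) \<tau> = newton_elem G n"
  unfolding coeff_f_def partition_trace_beta diff_Suc_1
  by (rule newton_elem_cong) (rule eisenstein_G_eq)

text \<open>
  The sum defining \<open>g\<close> in the shape in which it comes out as a limit at \<open>0\<close>. Its last index gives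
  the value of \<open>e'\<^bsub>r+1\<^esub>\<close>, where the convention \<open>G\<^sub>0 = -1\<close> makes the coefficient \<open>1\<close>; the index
  before that gives the constant term of \<open>\<wp>\<^sub>2\<close>; all smaller ones form the coefficient of \<open>z\<^sup>2\<close> in
  \<open>e'\<^sub>r\<close>.
\<close>

lemma coeff_g_eq:
  "coeff_g (Suc r) \<tau> = newton_elem G (Suc r)
     + (\<Sum>i<r. newton_elem G i * ((-1) ^ (r - 1 - i) * (2 * of_nat (r - i) + 1) * G (r - i + 1)))
     - newton_elem G r * G 1"
proof -
  let ?t = "\<lambda>t. (-1) ^ (Suc r - t) * (2 * of_nat (Suc r - t) - 1) *
        eisenstein_G (2 * (Suc r - t)) \<tau> * coeff_f (t + 1) \<tau> :: complex"
  have "coeff_g (Suc r) \<tau> = (\<Sum>t<r. ?t t) + ?t r + ?t (Suc r)"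
    unfolding coeff_g_def
    by (simp only: atLeast0AtMost lessThan_Suc_atMost[symmetric] sum.lessThan_Suc)
  also have "?t (Suc r) = newton_elem G (Suc r)"
    using coeff_f_eq[of "Suc r"] by (simp add: eisenstein_G_def del: newton_elem.simps)
  also have "?t r = - (newton_elem G r * G 1)"
    using coeff_f_eq[of r] eisenstein_G_eq[of 1] by simp
  also have "(\<Sum>t<r. ?t t) = (\<Sum>i<r. newton_elem G i * ((-1) ^ (r - 1 - i) * (2 * of_nat (r - i) + 1) * G (r - i + 1)))"
  proof (rule sum.cong)
    fix i assume "i \<in> {..<r}"
    then obtain m where m: "r = Suc (i + m)" using less_imp_Suc_add by blast
    then have *: "Suc r - i = Suc (Suc m)" "r - 1 - i = m" "r - i = Suc m" by auto
    show "?t i = newton_elem G i * ((-1) ^ (r - 1 - i) * (2 * of_nat (r - i) + 1) * G (r - i + 1))"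
      unfolding * using eisenstein_G_eq[of "Suc (Suc m)"] coeff_f_eq[of i]
      by (simp add: algebra_simps)
  qed simp
  finally show ?thesis by (simp add: algebra_simps)
qed

text \<open>
  Write the punctured power sums as their values at \<open>0\<close> plus terms \<open>q\<^sub>k\<close> of order \<open>z\<^sup>2\<close>. By
  multiplicativity \<open>e'\<close> is a convolution, and in its second factor only the linear term
  \<open>(-1)\<^bsup>k-1\<^esup> q\<^sub>k / k\<close> counts, with \<open>q\<^sub>k / z\<^sup>2 \<longlongrightarrow> k (2k + 1) G\<^bsub>2k+2\<^esub>\<close>.
\<close>

lemma punctured_elem_quadratic_coeff:
  "((\<lambda>z. (punctured_elem r z - newton_elem G r) / z\<^sup>2) \<longlongrightarrow>
     (\<Sum>i<r. newton_elem G i * ((-1) ^ (r - 1 - i) * (2 * of_nat (r - i) + 1) * G (r - i + 1)))) (at 0)"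
proof -
  define q where "q z k = lattice_series punctured (2 * k) z - G k" for z k
  have lim: "((\<lambda>z. newton_elem (q z) (r - i) / z\<^sup>2) \<longlongrightarrow>
      (-1) ^ (r - 1 - i) * (2 * of_nat (r - i) + 1) * G (r - i + 1)) (at 0)" if "i < r" for i
  proof -
    obtain m where m: "r = Suc (i + m)" using less_imp_Suc_add \<open>i < r\<close> by blast
    then have *: "r - i = Suc m" "r - 1 - i = m" by auto
    have "((\<lambda>z. newton_elem (q z) (Suc m) / z\<^sup>2) \<longlongrightarrow>
        (-1) ^ m * (of_nat (Suc m) * (2 * of_nat (Suc m) + 1) * G (Suc m + 1)) / of_nat (Suc m)) (at 0)"
      by (rule newton_elem_linear_term)
         (use lattice_series_quadratic_coeff in \<open>simp add: q_def\<close>)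
    also have "(-1) ^ m * (of_nat (Suc m) * (2 * of_nat (Suc m) + 1) * G (Suc m + 1)) / of_nat (Suc m) =
        (-1) ^ m * (2 * of_nat (Suc m) + 1) * G (Suc m + 1)"
      by (simp del: of_nat_Suc)
    finally show ?thesis unfolding * .
  qed
  have "(punctured_elem r z - newton_elem G r) / z\<^sup>2 =
      (\<Sum>i<r. newton_elem G i * (newton_elem (q z) (r - i) / z\<^sup>2))" for z
  proof -
    have "punctured_elem r z = newton_elem (\<lambda>k. G k + q z k) r" by (simp add: q_def)
    also have "\<dots> = (\<Sum>i<r. newton_elem G i * newton_elem (q z) (r - i)) + newton_elem G r"
      by (simp add: newton_elem_add lessThan_Suc_atMost[symmetric])
    finally show ?thesis by (simp add: sum_divide_distrib)
  qed
  then show ?thesis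
    by (simp only:) (intro tendsto_sum tendsto_mult tendsto_const lim; simp)
qed

section \<open>Liouville's theorem\<close>

lemma reduce_mod_lattice: "\<exists>u q. norm u \<le> norm \<tau> + 1 \<and> z = u + pt q"
proof -
  define a where "a = Im z / Im \<tau>"
  define b where "b = Re z - a * Re \<tau>"
  have z: "z = of_real a * \<tau> + of_real b"
    using Im_tau by (simp add: complex_eq_iff a_def b_def)
  define u where "u = of_real (frac a) * \<tau> + of_real (frac b)"
  have "norm u \<le> \<bar>frac a\<bar> * norm \<tau> + \<bar>frac b\<bar>"
    unfolding u_def by (rule norm_triangle_le) (simp add: norm_mult)
  also have "\<dots> \<le> 1 * norm \<tau> + 1"
    using frac_lt_1[of a] frac_lt_1[of b] by (intro add_mono mult_right_mono) auto
  finally have "norm u \<le> norm \<tau> + 1" by simp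
  moreover have "z = u + pt (\<lfloor>a\<rfloor>, \<lfloor>b\<rfloor>)"
    by (simp add: z u_def pt_def frac_def algebra_simps)
  ultimately show ?thesis by blast
qed

text \<open>
  Extended by \<open>B\<close> at all lattice points, \<open>h\<close> is entire: near \<open>0\<close> by removal of the singularity,
  near the other lattice points by periodicity. Its values are those on a compact disc that contains
  a fundamental parallelogram, so that Liouville's theorem applies.
\<close>

lemma lattice_invariant_constant:
  assumes hol: "h holomorphic_on - range pt"
    and per: "\<And>z q. z \<notin> range pt \<Longrightarrow> h (z + pt q) = h z"
    and lim: "(h \<longlongrightarrow> B) (at 0)"
    and z: "z \<notin> range pt"
  shows "h z = B"
proof -
  define H where "H z = (if z \<in> range pt then B else h z)" for z
  have H_per: "H (z + pt q) = H z" for z q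
    by (simp add: H_def per shift_mem_lattice)
  have 0: "(0 :: complex) \<in> range pt" by (metis pt_zero rangeI)
  have "0 \<in> - (pt ` punctured)" by (simp add: zero_notin_punctured)
  then obtain d where d: "d > 0" "ball 0 d \<subseteq> - (pt ` punctured)"
    using openE[OF open_compl_pt] by blast
  then have sub: "ball 0 d - {0} \<subseteq> - range pt" by (auto simp: pt_punctured)
  have hol_off: "H holomorphic_on - range pt"
    by (rule holomorphic_transform[OF hol]) (simp add: H_def)
  have hol0: "H holomorphic_on ball 0 d"
  proof (rule no_isolated_singularity'[where K = "{0}"])
    have "(h \<longlongrightarrow> H 0) (at 0)" using lim 0 by (simp add: H_def)
    moreover have "\<forall>\<^sub>F w in at 0. h w = H w"
      unfolding eventually_at using d(1) sub by (intro exI[of _ d]) (auto simp: H_def dist_norm)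
    ultimately have "(H \<longlongrightarrow> H 0) (at 0)" by (rule Lim_transform_eventually)
    then show "(H \<longlongrightarrow> H w) (at w within ball 0 d)" if "w \<in> {0}" for w
      using that by (auto intro: tendsto_within_subset)
    show "H holomorphic_on ball 0 d - {0}"
      by (rule holomorphic_on_subset[OF hol_off sub])
  qed auto
  have "H field_differentiable (at w)" for w
  proof (cases "w \<in> range pt")
    case False
    then show ?thesis
      using hol_off open_compl_pt[of UNIV] by (auto simp: holomorphic_on_open field_differentiable_def)
  next
    case True
    then obtain q where q: "w = pt q" by auto
    have "H field_differentiable (at (w - pt q))"
      using hol0 d(1) q by (auto simp: holomorphic_on_open field_differentiable_def)
    then obtain D where "(H has_field_derivative D) (at (w - pt q))"
      by (auto simp: field_differentiable_def)
    then have "((\<lambda>u. H (u - pt q)) has_field_derivative D) (at w)"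
      using DERIV_shift[of H D w "- pt q"] by simp
    moreover have "H (u - pt q) = H u" for u using H_per[of "u - pt q" q] by simp
    ultimately show ?thesis by (auto simp: field_differentiable_def)
  qed
  then have entire: "H holomorphic_on UNIV"
    by (auto simp: holomorphic_on_def)
  have "range H \<subseteq> H ` cball 0 (norm \<tau> + 1)"
  proof
    fix y assume "y \<in> range H"
    then obtain w where w: "y = H w" by auto
    obtain u q where "norm u \<le> norm \<tau> + 1" "w = u + pt q" using reduce_mod_lattice by blast
    then show "y \<in> H ` cball 0 (norm \<tau> + 1)" using w H_per by auto
  qed
  moreover have "compact (H ` cball 0 (norm \<tau> + 1))"
    using entire by (intro compact_continuous_image holomorphic_on_imp_continuous_on)
      (auto intro: holomorphic_on_subset)
  ultimately have "bounded (range H)" by (meson bounded_subset compact_imp_bounded)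
  then have "H constant_on UNIV" using Liouville_theorem[OF entire] by blast
  then have "H z = H 0" unfolding constant_on_def by (metis UNIV_I)
  then show ?thesis using z 0 by (simp add: H_def)
qed

text \<open>
  Liouville's theorem applied to \<open>e\<^sub>r - f\<^sub>r \<wp>\<^sub>2\<close>. Separating the point \<open>0\<close> writes it as
  \<open>e'\<^sub>r(z) + (e'\<^bsub>r-1\<^esub>(z) - f\<^sub>r) / z\<^sup>2 - f\<^sub>r P'\<^sub>1(z)\<close>, each part of which has a limit at \<open>0\<close>.
\<close>

lemma newton_elem_lattice_series_eq:
  assumes z: "z \<notin> range pt"
  shows "newton_elem (\<lambda>k. lattice_series UNIV (2 * k) z) (Suc r) =
           coeff_f (Suc r) \<tau> * lattice_series UNIV 2 z + coeff_g (Suc r) \<tau>"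
proof -
  define h where "h z = newton_elem (\<lambda>k. lattice_series UNIV (2 * k) z) (Suc r)
      - newton_elem G r * lattice_series UNIV 2 z" for z
  have "h z = coeff_g (Suc r) \<tau>"
  proof (rule lattice_invariant_constant[OF _ _ _ z])
    show "h holomorphic_on - range pt"
      unfolding h_def
      by (intro holomorphic_on_diff holomorphic_on_mult holomorphic_on_const
          holomorphic_newton_elem lattice_series_holomorphic) auto
    show "h (w + pt q) = h w" if "w \<notin> range pt" for w q
    proof -
      have "newton_elem (\<lambda>k. lattice_series UNIV (2 * k) (w + pt q)) (Suc r) =
          newton_elem (\<lambda>k. lattice_series UNIV (2 * k) w) (Suc r)"
        by (rule newton_elem_cong) (use lattice_series_periodic[OF that] in auto)
      then show ?thesis
        unfolding h_def using lattice_series_periodic[OF that, of 2 q] by simp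
    qed
    have near: "h w = punctured_elem (Suc r) w + (punctured_elem r w - newton_elem G r) / w\<^sup>2
        - newton_elem G r * lattice_series punctured 2 w" if w: "w \<notin> range pt" for w
    proof -
      have "newton_elem (\<lambda>k. lattice_series UNIV (2 * k) w) (Suc r) =
          newton_elem (\<lambda>k. lattice_series punctured (2 * k) w + (1 / w\<^sup>2) ^ k) (Suc r)"
        by (rule newton_elem_cong)
           (use w in \<open>simp add: lattice_series_UNIV power_one_over power_mult\<close>)
      then show ?thesis
        unfolding h_def newton_elem_add_powers lattice_series_UNIV[OF w order_refl]
        by (simp add: diff_divide_distrib distrib_left del: newton_elem.simps)
    qed
    have cont: "(lattice_series punctured (2 * k) \<longlongrightarrow> G k) (at 0)" if "1 \<le> k" for k
      using lattice_series_deriv[of punctured "2 * k" 0] zero_notin_punctured that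
      by (intro isContD DERIV_isCont) auto
    have "((\<lambda>w. punctured_elem (Suc r) w + (punctured_elem r w - newton_elem G r) / w\<^sup>2
        - newton_elem G r * lattice_series punctured 2 w) \<longlongrightarrow> coeff_g (Suc r) \<tau>) (at 0)"
      unfolding coeff_g_eq
      by (intro tendsto_diff tendsto_add tendsto_mult tendsto_const punctured_elem_quadratic_coeff
          tendsto_newton_elem cont) (use cont[of 1] in simp_all)
    moreover have "\<forall>\<^sub>F w in at 0. (w :: complex) \<notin> range pt"
    proof -
      have "\<forall>\<^sub>F w in nhds 0. (w :: complex) \<in> - pt ` punctured"
        by (rule eventually_nhds_in_open[OF open_compl_pt]) (use zero_notin_punctured in auto)
      then show ?thesis
        unfolding eventually_at_filter
        by eventually_elim (auto simp: pt_punctured)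
    qed
    then have "\<forall>\<^sub>F w in at 0. punctured_elem (Suc r) w + (punctured_elem r w - newton_elem G r) / w\<^sup>2
        - newton_elem G r * lattice_series punctured 2 w = h w"
      by eventually_elim (rule near[symmetric])
    ultimately show "(h \<longlongrightarrow> coeff_g (Suc r) \<tau>) (at 0)" by (rule Lim_transform_eventually)
  qed
  then show ?thesis by (simp add: h_def coeff_f_eq algebra_simps del: newton_elem.simps)
qed

end

theorem theorem3p7:
  fixes \<tau> z :: complex and r :: nat
  assumes "Im \<tau> > 0" and "r \<ge> 1" and "z \<notin> period_lattice \<tau>"
  shows "multiple_wp (replicate r 2) z \<tau> = coeff_f r \<tau> * multiple_wp [2] z \<tau> + coeff_g r \<tau>"
proof -
  interpret upper_half_plane_point \<tau> by unfold_locales (rule assms(1))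
  obtain s where r: "r = Suc s" using assms(2) by (cases r) auto
  have "multiple_wp [2] z \<tau> = lattice_series UNIV 2 z"
    using multiple_wp_eq_newton[OF assms(3), of 1] by simp
  then show ?thesis
    using multiple_wp_eq_newton[OF assms(3), of r] newton_elem_lattice_series_eq[of z s] assms(3)
    by (simp add: r range_pt del: newton_elem.simps replicate.simps)
qed

end
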